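(* Let $(B(t))_{t\in\mathbb{Z}}$ be a centered complex-valued wide sense stationary sequence having spectral density $f$ on $[-\pi,\pi)$ (i.e. its spectral measure is $\mu(du)=f(u)\,du$), and let $L$ be a linear filter with measurable frequency characteristic $\ell:[-\pi,\pi)\to\mathbb{C}$. Let $$\sigma_{\mathrm{int}}^2:=\inf_{Y\in H_1^\circ\cap\mathcal{D}(L)}\left(\mathbb{E}|Y-B(0)|^2+\mathbb{E}|LY|^2\right),$$ where $H_1^\circ$ is the closed linear span of $\{B(s):s\in\mathbb{Z},|s|\ge1\}$. If $$\int_{-\pi}^{\pi}\frac{du}{f(u)}=\infty,$$ then $$\sigma_{\mathrm{int}}^2=\int_{-\pi}^{\pi}\frac{|\ell(u)|^2}{1+|\ell(u)|^2}\,f(u)\,du.$$ Otherwise, $$\sigma_{\mathrm{int}}^2=\int_{-\pi}^{\pi}\frac{|\ell(u)|^2f(u)\,du}{1+|\ell(u)|^2}+\left(\int_{-\pi}^{\pi}\frac{du}{1+|\ell(u)|^2}\right)^2\left(\int_{-\pi}^{\pi}\frac{du}{f(u)(1+|\ell(u)|^2)}\right)^{-1}.$$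
   Context: A centered complex-valued sequence $(B(t))_{t\in\mathbb{Z}}$ is wide sense stationary if $\mathbb{E}B(t)=0$, $\mathbb{E}|B(t)|^2<\infty$ and $\mathbb{E}B(t+s)\overline{B(s)}=:K(t)$ does not depend on $s$. Its spectral measure is the finite measure $\mu$ on $[-\pi,\pi)$ with $K(t)=\int_{-\pi}^{\pi} e^{itu}\mu(du)$; one has $B(t)=\int e^{itu}\,\mathcal{W}(du)$ with an orthogonal random measure $\mathcal{W}$, $\mathbb{E}|\mathcal{W}(A)|^2=\mu(A)$. $H$ is the closed linear span of $\{B(s):s\in\mathbb{Z}\}$ in the Hilbert space of square integrable random variables. The stochastic integral $\phi\mapsto\int\phi\,d\mathcal{W}$ is a linear isometry of $L_2(\mu)$ onto $H$; for $\xi\in H$ write $\xi=\int\phi_\xi\,d\mathcal{W}$. The linear filter $L$ with frequency characteristic $\ell$ is $L\xi=\int\ell(u)\phi_\xi(u)\,\mathcal{W}(du)$ with domain $\mathcal{D}(L)=\{\xi\in H:\int|\ell\phi_\xi|^2d\mu<\infty\}$. Convention: $1/f(u)=\infty$ where $f(u)=0$. *)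

theory Defs
  imports "HOL-Probability.Probability"
begin

definition square_integrable :: "'a measure \<Rightarrow> ('a \<Rightarrow> complex) \<Rightarrow> bool" where
  "square_integrable M X \<longleftrightarrow>
     X \<in> borel_measurable M \<and> integrable M (\<lambda>\<omega>. (cmod (X \<omega>))\<^sup>2)"

definition L2_dist_sq :: "'a measure \<Rightarrow> ('a \<Rightarrow> complex) \<Rightarrow> ('a \<Rightarrow> complex) \<Rightarrow> real" where
  "L2_dist_sq M X Y = (\<integral>\<omega>. (cmod (X \<omega> - Y \<omega>))\<^sup>2 \<partial>M)"

text \<open>Elements of \<open>L\<^sub>2\<close> are represented by functions; equality in \<open>L\<^sub>2\<close> is almost everywhere
  equality.  The following is the closed complex linear span of \<open>{B s | s \<in> T}\<close>.\<close>

definition closed_span :: "'a measure \<Rightarrow> (int \<Rightarrow> 'a \<Rightarrow> complex) \<Rightarrow> int set \<Rightarrow> ('a \<Rightarrow> complex) set" where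
  "closed_span M B T =
     {X. square_integrable M X \<and>
         (\<forall>\<epsilon>>0. \<exists>F c. finite F \<and> F \<subseteq> T \<and> L2_dist_sq M X (\<lambda>\<omega>. \<Sum>s\<in>F. c s * B s \<omega>) < \<epsilon>)}"

definition autocovariance :: "'a measure \<Rightarrow> (int \<Rightarrow> 'a \<Rightarrow> complex) \<Rightarrow> int \<Rightarrow> complex" where
  "autocovariance M B t = (\<integral>\<omega>. B t \<omega> * cnj (B 0 \<omega>) \<partial>M)"

definition wide_sense_stationary :: "'a measure \<Rightarrow> (int \<Rightarrow> 'a \<Rightarrow> complex) \<Rightarrow> bool" where
  "wide_sense_stationary M B \<longleftrightarrow>
     (\<forall>t. square_integrable M (B t) \<and> (\<integral>\<omega>. B t \<omega> \<partial>M) = 0) \<and>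
     (\<forall>t s. (\<integral>\<omega>. B (t + s) \<omega> * cnj (B s \<omega>) \<partial>M) = autocovariance M B t)"

abbreviation leb_circle :: "real measure" where
  "leb_circle \<equiv> restrict_space lborel {-pi..<pi}"

definition is_spectral_measure ::
    "'a measure \<Rightarrow> (int \<Rightarrow> 'a \<Rightarrow> complex) \<Rightarrow> real measure \<Rightarrow> bool" where
  "is_spectral_measure M B \<mu> \<longleftrightarrow>
     finite_measure \<mu> \<and> sets \<mu> = sets leb_circle \<and>
     (\<forall>t. autocovariance M B t = (\<integral>u. cis (of_int t * u) \<partial>\<mu>))"

abbreviation density_measure :: "(real \<Rightarrow> real) \<Rightarrow> real measure" where
  "density_measure f \<equiv> density leb_circle (\<lambda>u. ennreal (f u))"

definition has_spectral_density ::
    "'a measure \<Rightarrow> (int \<Rightarrow> 'a \<Rightarrow> complex) \<Rightarrow> (real \<Rightarrow> real) \<Rightarrow> bool" where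
  "has_spectral_density M B f \<longleftrightarrow>
     f \<in> borel_measurable leb_circle \<and> (\<forall>u\<in>{-pi..<pi}. 0 \<le> f u) \<and>
     is_spectral_measure M B (density_measure f)"

definition orthogonal_random_measure ::
    "'a measure \<Rightarrow> real measure \<Rightarrow> (real set \<Rightarrow> 'a \<Rightarrow> complex) \<Rightarrow> bool" where
  "orthogonal_random_measure M \<mu> W \<longleftrightarrow>
     (\<forall>A\<in>sets \<mu>. square_integrable M (W A) \<and>
                 (\<integral>\<omega>. (cmod (W A \<omega>))\<^sup>2 \<partial>M) = measure \<mu> A) \<and>
     (\<forall>A\<in>sets \<mu>. \<forall>A'\<in>sets \<mu>. A \<inter> A' = {} \<longrightarrow>
        (AE \<omega> in M. W (A \<union> A') \<omega> = W A \<omega> + W A' \<omega>) \<and>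
        (\<integral>\<omega>. W A \<omega> * cnj (W A' \<omega>) \<partial>M) = 0)"

text \<open>The stochastic integral with respect to \<open>W\<close>: on simple functions by the usual finite sum,
  then extended to \<open>L\<^sub>2(\<mu>)\<close> by mean-square limits.\<close>

definition simple_stoch_integral ::
    "real measure \<Rightarrow> (real set \<Rightarrow> 'a \<Rightarrow> complex) \<Rightarrow> (real \<Rightarrow> complex) \<Rightarrow> 'a \<Rightarrow> complex" where
  "simple_stoch_integral \<mu> W \<phi> \<omega> =
     (\<Sum>y\<in>\<phi> ` space \<mu>. y * W (\<phi> -` {y} \<inter> space \<mu>) \<omega>)"

definition has_stoch_integral ::
    "'a measure \<Rightarrow> real measure \<Rightarrow> (real set \<Rightarrow> 'a \<Rightarrow> complex) \<Rightarrow>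
     (real \<Rightarrow> complex) \<Rightarrow> ('a \<Rightarrow> complex) \<Rightarrow> bool" where
  "has_stoch_integral M \<mu> W \<phi> \<xi> \<longleftrightarrow>
     square_integrable \<mu> \<phi> \<and> square_integrable M \<xi> \<and>
     (\<exists>\<psi>. (\<forall>n. simple_function \<mu> (\<psi> n)) \<and>
          (\<lambda>n. L2_dist_sq \<mu> (\<psi> n) \<phi>) \<longlonglongrightarrow> 0 \<and>
          (\<lambda>n. L2_dist_sq M (simple_stoch_integral \<mu> W (\<psi> n)) \<xi>) \<longlonglongrightarrow> 0)"

text \<open>The choices below are unique up to null sets: the integral is an isometry of \<open>L\<^sub>2(\<mu>)\<close>
  into \<open>L\<^sub>2(M)\<close>.\<close>

definition stoch_integral ::
    "'a measure \<Rightarrow> real measure \<Rightarrow> (real set \<Rightarrow> 'a \<Rightarrow> complex) \<Rightarrow>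
     (real \<Rightarrow> complex) \<Rightarrow> 'a \<Rightarrow> complex" where
  "stoch_integral M \<mu> W \<phi> = (SOME \<xi>. has_stoch_integral M \<mu> W \<phi> \<xi>)"

definition integrand ::
    "'a measure \<Rightarrow> real measure \<Rightarrow> (real set \<Rightarrow> 'a \<Rightarrow> complex) \<Rightarrow>
     ('a \<Rightarrow> complex) \<Rightarrow> real \<Rightarrow> complex" where
  "integrand M \<mu> W \<xi> = (SOME \<phi>. has_stoch_integral M \<mu> W \<phi> \<xi>)"

definition spectral_representation ::
    "'a measure \<Rightarrow> (int \<Rightarrow> 'a \<Rightarrow> complex) \<Rightarrow> real measure \<Rightarrow>
     (real set \<Rightarrow> 'a \<Rightarrow> complex) \<Rightarrow> bool" where
  "spectral_representation M B \<mu> W \<longleftrightarrow>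
     orthogonal_random_measure M \<mu> W \<and>
     (\<forall>t. has_stoch_integral M \<mu> W (\<lambda>u. cis (of_int t * u)) (B t))"

definition filter_domain ::
    "'a measure \<Rightarrow> (int \<Rightarrow> 'a \<Rightarrow> complex) \<Rightarrow> real measure \<Rightarrow>
     (real set \<Rightarrow> 'a \<Rightarrow> complex) \<Rightarrow> (real \<Rightarrow> complex) \<Rightarrow> ('a \<Rightarrow> complex) set" where
  "filter_domain M B \<mu> W l =
     {\<xi> \<in> closed_span M B UNIV. square_integrable \<mu> (\<lambda>u. l u * integrand M \<mu> W \<xi> u)}"

definition linear_filter ::
    "'a measure \<Rightarrow> real measure \<Rightarrow> (real set \<Rightarrow> 'a \<Rightarrow> complex) \<Rightarrow> (real \<Rightarrow> complex) \<Rightarrow>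
     ('a \<Rightarrow> complex) \<Rightarrow> 'a \<Rightarrow> complex" where
  "linear_filter M \<mu> W l \<xi> = stoch_integral M \<mu> W (\<lambda>u. l u * integrand M \<mu> W \<xi> u)"

definition sigma_int_sq ::
    "'a measure \<Rightarrow> (int \<Rightarrow> 'a \<Rightarrow> complex) \<Rightarrow> real measure \<Rightarrow>
     (real set \<Rightarrow> 'a \<Rightarrow> complex) \<Rightarrow> (real \<Rightarrow> complex) \<Rightarrow> real" where
  "sigma_int_sq M B \<mu> W l =
     (INF Y \<in> closed_span M B {s. \<bar>s\<bar> \<ge> 1} \<inter> filter_domain M B \<mu> W l.
        (\<integral>\<omega>. (cmod (Y \<omega> - B 0 \<omega>))\<^sup>2 \<partial>M) + (\<integral>\<omega>. (cmod (linear_filter M \<mu> W l Y \<omega>))\<^sup>2 \<partial>M))"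

end

theory Submission
  imports Defs "HOL-Complex_Analysis.Cauchy_Integral_Theorem"
begin

text \<open>
  Let \<open>\<mu>\<close> have density \<open>f\<close>. The stochastic integral is an isometry under which \<open>B s\<close> corresponds to the
  character \<open>u \<mapsto> exp (i s u)\<close> and the filter to multiplication by \<open>l\<close>. The quantity to minimise therefore becomes
  \<open>\<integral> (\<bar>\<phi> - 1\<bar>\<^sup>2 + \<bar>l \<phi>\<bar>\<^sup>2) f du\<close>, where \<open>\<phi>\<close> ranges over the closed span in \<open>L\<^sub>2(\<mu>)\<close> of the
  characters with \<open>s \<noteq> 0\<close> (\<open>sigma_int_sq_eqI\<close>). With \<open>a = 1 + \<bar>l\<bar>\<^sup>2\<close>, completing the square turns it into
  \<open>\<integral> \<bar>l\<bar>\<^sup>2 f / a du + \<integral> a f \<bar>\<phi> - 1 / a\<bar>\<^sup>2 du\<close> (\<open>amp_identity\<close>). The first term is the common part of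
  both formulas, and the question is how close \<open>\<phi>\<close> can come to \<open>1 / a\<close>.

  This depends on the orthogonal complement of the characters with \<open>s \<noteq> 0\<close>. If \<open>r\<close> belongs to it, all
  Fourier coefficients of the integrable function \<open>f r\<close> but one vanish, hence \<open>f r\<close> is a constant \<open>c\<close>
  (\<open>orthogonal_to_nonzero_characters\<close>, which rests on the uniqueness of Fourier coefficients).
  The squared norm of \<open>r = c / f\<close> is \<open>\<bar>c\<bar>\<^sup>2 \<integral> 1 / f du\<close>.

  If \<open>\<integral> 1 / f du = \<infinity>\<close>, the complement is trivial, every \<open>\<phi>\<close> is admissible, and \<open>\<phi> = 1 / a\<close> makes the
  second term vanish.

  If \<open>\<integral> 1 / f du < \<infinity>\<close>, the complement is spanned by \<open>1 / f\<close>, and since the inner product with \<open>1 / f\<close> is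
  integration against \<open>du\<close>, the closed span consists of the \<open>\<phi>\<close> with \<open>\<integral> \<phi> du = 0\<close>
  (\<open>closed_span_iff_integral_zero\<close>). Writing \<open>P = \<integral> 1 / a du\<close> and \<open>D = \<integral> 1 / (a f) du\<close>, Cauchy-Schwarz gives
  \<open>P\<^sup>2 = \<bar>\<integral> (\<phi> - 1 / a) du\<bar>\<^sup>2 \<le> D \<integral> a f \<bar>\<phi> - 1 / a\<bar>\<^sup>2 du\<close>, with equality for
  \<open>\<phi> = 1 / a - (P / D) / (a f)\<close>. So the second term has minimum \<open>P\<^sup>2 / D\<close>.
\<close>

section \<open>Square integrable functions and their inner product\<close>

definition ip :: "'a measure \<Rightarrow> ('a \<Rightarrow> complex) \<Rightarrow> ('a \<Rightarrow> complex) \<Rightarrow> complex" where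
  "ip N X Y = (\<integral>x. X x * cnj (Y x) \<partial>N)"

lemma square_integrable_measurable: "square_integrable N X \<Longrightarrow> X \<in> borel_measurable N"
  by (simp add: square_integrable_def)

lemma norm_add_sq_le: "(cmod (a + b))\<^sup>2 \<le> 2 * (cmod a)\<^sup>2 + 2 * (cmod b)\<^sup>2"
proof -
  have "(cmod (a + b))\<^sup>2 \<le> (cmod a + cmod b)\<^sup>2"
    by (simp add: norm_triangle_ineq power_mono)
  also have "\<dots> \<le> 2 * (cmod a)\<^sup>2 + 2 * (cmod b)\<^sup>2"
    using sum_squares_bound[of "cmod a" "cmod b"] by (simp add: power2_sum)
  finally show ?thesis .
qed

lemma norm_mult_cnj_le: "2 * cmod (a * cnj b) \<le> (cmod a)\<^sup>2 + (cmod b)\<^sup>2"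
  using sum_squares_bound[of "cmod a" "cmod b"] by (simp add: norm_mult)

lemma square_integrable_bound:
  assumes "Y \<in> borel_measurable N" "integrable N g" "AE x in N. (cmod (Y x))\<^sup>2 \<le> g x"
  shows "square_integrable N Y"
  unfolding square_integrable_def
proof
  show "integrable N (\<lambda>x. (cmod (Y x))\<^sup>2)"
    by (rule Bochner_Integration.integrable_bound[OF assms(2)]) (use assms in auto)
qed fact

lemma square_integrable_add:
  assumes "square_integrable N X" "square_integrable N Y"
  shows "square_integrable N (\<lambda>x. X x + Y x)"
proof (rule square_integrable_bound)
  show "integrable N (\<lambda>x. 2 * (cmod (X x))\<^sup>2 + 2 * (cmod (Y x))\<^sup>2)"
    using assms by (simp add: square_integrable_def)
qed (use assms norm_add_sq_le in \<open>auto simp: square_integrable_def\<close>)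

lemma square_integrable_cmult:
  assumes "square_integrable N X"
  shows "square_integrable N (\<lambda>x. c * X x)"
proof (rule square_integrable_bound)
  show "integrable N (\<lambda>x. (cmod c)\<^sup>2 * (cmod (X x))\<^sup>2)"
    using assms by (simp add: square_integrable_def)
qed (use assms in \<open>auto simp: square_integrable_def norm_mult power_mult_distrib\<close>)

lemma square_integrable_diff:
  assumes "square_integrable N X" "square_integrable N Y"
  shows "square_integrable N (\<lambda>x. X x - Y x)"
  using square_integrable_add[OF assms(1) square_integrable_cmult[OF assms(2), of "-1"]] by simp

lemma square_integrable_zero [simp]: "square_integrable N (\<lambda>x. 0)"
  by (simp add: square_integrable_def)

lemma square_integrable_lincomb:
  assumes "\<And>i. i \<in> I \<Longrightarrow> square_integrable N (X i)"
  shows "square_integrable N (\<lambda>x. \<Sum>i\<in>I. c i * X i x)"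
  using assms
  by (induction I rule: infinite_finite_induct)
     (auto intro!: square_integrable_add square_integrable_cmult)

lemma borel_measurable_cnj [measurable (raw)]:
  "X \<in> borel_measurable N \<Longrightarrow> (\<lambda>x. cnj (X x)) \<in> borel_measurable N"
  by (rule borel_measurable_continuous_on[OF continuous_on_cnj[OF continuous_on_id]])

lemma integrable_mult_cnj:
  assumes "square_integrable N X" "square_integrable N Y"
  shows "integrable N (\<lambda>x. X x * cnj (Y x))"
proof (rule Bochner_Integration.integrable_bound)
  show "integrable N (\<lambda>x. (cmod (X x))\<^sup>2 + (cmod (Y x))\<^sup>2)"
    using assms by (simp add: square_integrable_def)
  have [measurable]: "X \<in> borel_measurable N" "Y \<in> borel_measurable N"
    using assms by (simp_all add: square_integrable_def)
  show "(\<lambda>x. X x * cnj (Y x)) \<in> borel_measurable N"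
    by (intro borel_measurable_times borel_measurable_cnj) measurable
  have "cmod (X x * cnj (Y x)) \<le> (cmod (X x))\<^sup>2 + (cmod (Y x))\<^sup>2" for x
    using norm_mult_cnj_le[of "X x" "Y x"] norm_ge_zero[of "X x * cnj (Y x)"] by linarith
  then show "AE x in N. norm (X x * cnj (Y x)) \<le> norm ((cmod (X x))\<^sup>2 + (cmod (Y x))\<^sup>2)"
    by simp
qed

lemma ip_self: "ip N X X = of_real (\<integral>x. (cmod (X x))\<^sup>2 \<partial>N)"
proof -
  have "ip N X X = (\<integral>x. of_real ((cmod (X x))\<^sup>2) \<partial>N)"
    unfolding ip_def by (intro Bochner_Integration.integral_cong) (auto simp: complex_norm_square[symmetric])
  then show ?thesis by (simp only: integral_complex_of_real)
qed

lemma ip_cnj: "cnj (ip N X Y) = ip N Y X"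
proof -
  have "cnj (ip N X Y) = (\<integral>x. cnj (X x * cnj (Y x)) \<partial>N)"
    unfolding ip_def by (rule Bochner_Integration.integral_cnj[symmetric])
  then show ?thesis unfolding ip_def by (simp add: mult.commute)
qed

lemma ip_cmult_left: "ip N (\<lambda>x. z * X x) Y = z * ip N X Y"
  unfolding ip_def by (simp add: mult.assoc)

lemma ip_cmult_right: "ip N X (\<lambda>x. z * Y x) = cnj z * ip N X Y"
  unfolding ip_def by (simp add: mult.left_commute)

lemma ip_diff_left:
  assumes "square_integrable N X" "square_integrable N X'" "square_integrable N Y"
  shows "ip N (\<lambda>x. X x - X' x) Y = ip N X Y - ip N X' Y"
  unfolding ip_def
  by (simp add: left_diff_distrib Bochner_Integration.integral_diff integrable_mult_cnj assms)

lemma ip_diff_right: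
  assumes "square_integrable N X" "square_integrable N Y" "square_integrable N Y'"
  shows "ip N X (\<lambda>x. Y x - Y' x) = ip N X Y - ip N X Y'"
  unfolding ip_def
  by (simp add: right_diff_distrib Bochner_Integration.integral_diff integrable_mult_cnj assms)

lemma ip_add_left:
  assumes "square_integrable N X" "square_integrable N X'" "square_integrable N Y"
  shows "ip N (\<lambda>x. X x + X' x) Y = ip N X Y + ip N X' Y"
  unfolding ip_def by (simp add: distrib_right integrable_mult_cnj assms)

lemma ip_add_right:
  assumes "square_integrable N X" "square_integrable N Y" "square_integrable N Y'"
  shows "ip N X (\<lambda>x. Y x + Y' x) = ip N X Y + ip N X Y'"
  unfolding ip_def by (simp add: distrib_left integrable_mult_cnj assms)

lemma ip_cong_AE:
  assumes "X \<in> borel_measurable N" "X' \<in> borel_measurable N" "Y \<in> borel_measurable N" "Y' \<in> borel_measurable N"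
    and "AE x in N. X x = X' x" "AE x in N. Y x = Y' x"
  shows "ip N X Y = ip N X' Y'"
  unfolding ip_def
proof (rule integral_cong_AE)
  show "AE x in N. X x * cnj (Y x) = X' x * cnj (Y' x)" using assms(5,6) by eventually_elim simp
qed (use assms in measurable)

lemma ip_lincomb:
  assumes "\<And>i. i \<in> I \<Longrightarrow> square_integrable N (X i)" "\<And>j. j \<in> J \<Longrightarrow> square_integrable N (Y j)"
  shows "ip N (\<lambda>x. \<Sum>i\<in>I. c i * X i x) (\<lambda>x. \<Sum>j\<in>J. d j * Y j x)
           = (\<Sum>i\<in>I. \<Sum>j\<in>J. c i * cnj (d j) * ip N (X i) (Y j))"
proof -
  have int: "integrable N (\<lambda>x. c i * cnj (d j) * (X i x * cnj (Y j x)))" if "i \<in> I" "j \<in> J" for i j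
    using assms that by (intro integrable_mult_right integrable_mult_cnj)
  have "ip N (\<lambda>x. \<Sum>i\<in>I. c i * X i x) (\<lambda>x. \<Sum>j\<in>J. d j * Y j x)
      = (\<integral>x. (\<Sum>i\<in>I. \<Sum>j\<in>J. c i * cnj (d j) * (X i x * cnj (Y j x))) \<partial>N)"
    unfolding ip_def by (simp add: sum_product algebra_simps)
  also have "\<dots> = (\<Sum>i\<in>I. \<integral>x. (\<Sum>j\<in>J. c i * cnj (d j) * (X i x * cnj (Y j x))) \<partial>N)"
    by (intro Bochner_Integration.integral_sum Bochner_Integration.integrable_sum int)
  also have "\<dots> = (\<Sum>i\<in>I. \<Sum>j\<in>J. \<integral>x. c i * cnj (d j) * (X i x * cnj (Y j x)) \<partial>N)"
    by (intro sum.cong refl Bochner_Integration.integral_sum int)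
  also have "\<dots> = (\<Sum>i\<in>I. \<Sum>j\<in>J. c i * cnj (d j) * ip N (X i) (Y j))"
    unfolding ip_def by simp
  finally show ?thesis .
qed

lemma L2_dist_sq_ip:
  assumes "square_integrable N X" "square_integrable N Y"
  shows "L2_dist_sq N X Y = Re (ip N X X - ip N X Y - ip N Y X + ip N Y Y)"
proof -
  have "complex_of_real (L2_dist_sq N X Y) = ip N (\<lambda>x. X x - Y x) (\<lambda>x. X x - Y x)"
    unfolding L2_dist_sq_def ip_self ..
  also have "\<dots> = ip N X X - ip N X Y - ip N Y X + ip N Y Y"
    by (simp add: ip_diff_left ip_diff_right square_integrable_diff assms)
  finally show ?thesis by (metis Re_complex_of_real)
qed

lemma L2_dist_sq_nonneg [simp]: "0 \<le> L2_dist_sq N X Y"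
  unfolding L2_dist_sq_def by simp

lemma L2_dist_sq_commute: "L2_dist_sq N X Y = L2_dist_sq N Y X"
  unfolding L2_dist_sq_def by (simp add: norm_minus_commute)

lemma L2_dist_sq_triangle:
  assumes "square_integrable N X" "square_integrable N Y" "square_integrable N Z"
  shows "L2_dist_sq N X Z \<le> 2 * L2_dist_sq N X Y + 2 * L2_dist_sq N Y Z"
proof -
  have "L2_dist_sq N X Z \<le> (\<integral>x. 2 * (cmod (X x - Y x))\<^sup>2 + 2 * (cmod (Y x - Z x))\<^sup>2 \<partial>N)"
    unfolding L2_dist_sq_def
  proof (rule integral_mono)
    show "(cmod (X x - Z x))\<^sup>2 \<le> 2 * (cmod (X x - Y x))\<^sup>2 + 2 * (cmod (Y x - Z x))\<^sup>2" for x
      using norm_add_sq_le[of "X x - Y x" "Y x - Z x"] by simp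
  qed (use square_integrable_diff[OF assms(1,3)] square_integrable_diff[OF assms(1,2)]
        square_integrable_diff[OF assms(2,3)] in \<open>auto simp: square_integrable_def\<close>)
  also have "\<dots> = 2 * L2_dist_sq N X Y + 2 * L2_dist_sq N Y Z"
    unfolding L2_dist_sq_def
    using square_integrable_diff[OF assms(1,2)] square_integrable_diff[OF assms(2,3)]
    by (simp add: square_integrable_def)
  finally show ?thesis .
qed

lemma L2_dist_sq_eq_0_iff:
  assumes "square_integrable N X" "square_integrable N Y"
  shows "L2_dist_sq N X Y = 0 \<longleftrightarrow> (AE x in N. X x = Y x)"
  unfolding L2_dist_sq_def
  using square_integrable_diff[OF assms]
  by (subst integral_nonneg_eq_0_iff_AE) (auto simp: square_integrable_def)

text \<open>Distances to linear combinations depend only on the Gram matrix. This is how approximation is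
  transported between the probability space and the spectral side.\<close>

lemma L2_dist_sq_lincomb_isometric:
  assumes X: "square_integrable N X" "square_integrable N' X'"
    and e: "\<And>s. s \<in> F \<Longrightarrow> square_integrable N (e s)" "\<And>s. s \<in> F \<Longrightarrow> square_integrable N' (e' s)"
    and ip: "ip N X X = ip N' X' X'" "\<And>s. s \<in> F \<Longrightarrow> ip N X (e s) = ip N' X' (e' s)"
      "\<And>s t. s \<in> F \<Longrightarrow> t \<in> F \<Longrightarrow> ip N (e s) (e t) = ip N' (e' s) (e' t)"
  shows "L2_dist_sq N X (\<lambda>x. \<Sum>s\<in>F. c s * e s x) = L2_dist_sq N' X' (\<lambda>x. \<Sum>s\<in>F. c s * e' s x)"
proof -
  let ?S = "\<lambda>x. \<Sum>s\<in>F. c s * e s x" and ?S' = "\<lambda>x. \<Sum>s\<in>F. c s * e' s x"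
  have 1: "ip N X ?S = ip N' X' ?S'"
    using ip_lincomb[of "{()}" N "\<lambda>_. X" F e "\<lambda>_. 1" c] ip_lincomb[of "{()}" N' "\<lambda>_. X'" F e' "\<lambda>_. 1" c]
      X e ip(2) by simp
  have "ip N ?S X = ip N' ?S' X'"
    using arg_cong[OF 1, of cnj] by (simp add: ip_cnj)
  moreover have "ip N ?S ?S = ip N' ?S' ?S'"
    using e ip(3) by (simp add: ip_lincomb)
  ultimately show ?thesis
    using 1 ip(1) X e by (simp add: L2_dist_sq_ip square_integrable_lincomb)
qed

text \<open>A weighted arithmetic-geometric bound; the choice of the weight gives the Cauchy-Schwarz
  inequality.\<close>

lemma norm_ip_le:
  assumes "square_integrable N X" "square_integrable N Y" "t > 0"
  shows "2 * cmod (ip N X Y) \<le> (\<integral>x. (cmod (X x))\<^sup>2 \<partial>N) / t + t * (\<integral>x. (cmod (Y x))\<^sup>2 \<partial>N)"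
proof -
  have "2 * cmod (ip N X Y) \<le> 2 * (\<integral>x. cmod (X x * cnj (Y x)) \<partial>N)"
    unfolding ip_def by simp
  also have "\<dots> = (\<integral>x. 2 * cmod (X x * cnj (Y x)) \<partial>N)" by simp
  also have "\<dots> \<le> (\<integral>x. (cmod (X x))\<^sup>2 / t + t * (cmod (Y x))\<^sup>2 \<partial>N)"
  proof (rule integral_mono)
    show "2 * cmod (X x * cnj (Y x)) \<le> (cmod (X x))\<^sup>2 / t + t * (cmod (Y x))\<^sup>2" for x
    proof -
      have "0 \<le> (cmod (X x) - t * cmod (Y x))\<^sup>2 / t" using \<open>t > 0\<close> by simp
      also have "\<dots> = (cmod (X x))\<^sup>2 / t + t * (cmod (Y x))\<^sup>2 - 2 * cmod (X x * cnj (Y x))"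
        using \<open>t > 0\<close> by (simp add: field_simps power2_eq_square norm_mult)
      finally show ?thesis by simp
    qed
  qed (use assms integrable_mult_cnj[OF assms(1,2)] in \<open>auto simp: square_integrable_def\<close>)
  also have "\<dots> = (\<integral>x. (cmod (X x))\<^sup>2 \<partial>N) / t + t * (\<integral>x. (cmod (Y x))\<^sup>2 \<partial>N)"
    using assms by (simp add: square_integrable_def)
  finally show ?thesis .
qed

lemma Cauchy_Schwarz_ip:
  assumes "square_integrable N X" "square_integrable N Y"
  shows "(cmod (ip N X Y))\<^sup>2 \<le> (\<integral>x. (cmod (X x))\<^sup>2 \<partial>N) * (\<integral>x. (cmod (Y x))\<^sup>2 \<partial>N)"
    (is "?c\<^sup>2 \<le> ?A * ?B")
proof -
  have nn: "0 \<le> ?A" "0 \<le> ?B" by auto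
  show ?thesis
  proof (cases "?c = 0 \<or> ?B = 0")
    case True
    have "AE x in N. Y x = 0" if "?B = 0"
      using that assms(2) L2_dist_sq_eq_0_iff[OF assms(2) square_integrable_zero]
      by (simp add: L2_dist_sq_def)
    then have "ip N X Y = 0" if "?B = 0"
      unfolding ip_def using that by (intro integral_eq_zero_AE) auto
    then show ?thesis using True by auto
  next
    case False
    then have pos: "?c > 0" "?B > 0" using nn by (auto simp: less_le)
    \<comment> \<open>The weight is chosen so that the second term of the bound is \<open>?c\<close>.\<close>
    then have "2 * ?c \<le> ?A / (?c / ?B) + (?c / ?B) * ?B"
      by (intro norm_ip_le assms) simp
    then show ?thesis using pos by (simp add: field_simps power2_eq_square)
  qed
qed

lemma ip_tendsto_0:
  assumes "\<And>n. square_integrable N (X n)" "\<And>n. square_integrable N (Y n)"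
    and "(\<lambda>n. (\<integral>x. (cmod (X n x))\<^sup>2 \<partial>N) * (\<integral>x. (cmod (Y n x))\<^sup>2 \<partial>N)) \<longlonglongrightarrow> 0"
  shows "(\<lambda>n. ip N (X n) (Y n)) \<longlonglongrightarrow> 0"
proof -
  have "(\<lambda>n. (cmod (ip N (X n) (Y n)))\<^sup>2) \<longlonglongrightarrow> 0"
    by (rule tendsto_sandwich[OF _ _ tendsto_const assms(3)])
       (use Cauchy_Schwarz_ip[OF assms(1,2)] in auto)
  then have "(\<lambda>n. sqrt ((cmod (ip N (X n) (Y n)))\<^sup>2)) \<longlonglongrightarrow> sqrt 0"
    by (rule tendsto_real_sqrt)
  then show ?thesis by (simp add: tendsto_norm_zero_iff)
qed

lemma ip_tendsto:
  assumes X: "\<And>n. square_integrable N (X n)" "square_integrable N X'"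
    and Y: "\<And>n. square_integrable N (Y n)" "square_integrable N Y'"
    and limX: "(\<lambda>n. L2_dist_sq N (X n) X') \<longlonglongrightarrow> 0"
    and limY: "(\<lambda>n. L2_dist_sq N (Y n) Y') \<longlonglongrightarrow> 0"
  shows "(\<lambda>n. ip N (X n) (Y n)) \<longlonglongrightarrow> ip N X' Y'"
proof -
  let ?dX = "\<lambda>n x. X n x - X' x" and ?dY = "\<lambda>n x. Y n x - Y' x"
  have eq: "ip N (X n) (Y n) = ip N (?dX n) (?dY n) + ip N (?dX n) Y' + ip N X' (?dY n) + ip N X' Y'" for n
    by (simp add: ip_diff_left ip_diff_right square_integrable_diff X Y)
  have "(\<lambda>n. ip N (?dX n) (?dY n)) \<longlonglongrightarrow> 0"
    by (rule ip_tendsto_0)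
       (use X Y tendsto_mult[OF limX limY] in \<open>auto simp: L2_dist_sq_def intro!: square_integrable_diff\<close>)
  moreover have "(\<lambda>n. ip N (?dX n) Y') \<longlonglongrightarrow> 0"
    by (rule ip_tendsto_0)
       (use X Y tendsto_mult_right[OF limX] in \<open>auto simp: L2_dist_sq_def intro!: square_integrable_diff\<close>)
  moreover have "(\<lambda>n. ip N X' (?dY n)) \<longlonglongrightarrow> 0"
    by (rule ip_tendsto_0)
       (use X Y tendsto_mult_left[OF limY] in \<open>auto simp: L2_dist_sq_def intro!: square_integrable_diff\<close>)
  ultimately have "(\<lambda>n. ip N (?dX n) (?dY n) + ip N (?dX n) Y' + ip N X' (?dY n) + ip N X' Y')
      \<longlonglongrightarrow> 0 + 0 + 0 + ip N X' Y'"
    by (intro tendsto_add tendsto_const)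
  then show ?thesis by (simp add: eq)
qed

section \<open>Completeness and orthogonal complements\<close>

lemma L2_dist_sq_tendsto:
  assumes X: "\<And>n. square_integrable N (X n)" "square_integrable N X'" and Y: "square_integrable N Y"
    and lim: "(\<lambda>n. L2_dist_sq N (X n) X') \<longlonglongrightarrow> 0"
  shows "(\<lambda>n. L2_dist_sq N (X n) Y) \<longlonglongrightarrow> L2_dist_sq N X' Y"
proof -
  have "(\<lambda>n. L2_dist_sq N Y Y) \<longlonglongrightarrow> 0" by (simp add: L2_dist_sq_def)
  then show ?thesis
    unfolding L2_dist_sq_ip[OF X(1) Y] L2_dist_sq_ip[OF X(2) Y]
    by (intro tendsto_Re tendsto_add tendsto_diff ip_tendsto X Y lim)
qed

text \<open>Along a subsequence whose consecutive squared distances are at most \<open>4 ^ (- k)\<close>, the sum of the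
  squared increments weighted by \<open>2 ^ k\<close> has a finite integral. So almost everywhere the increments are
  dominated by a geometric series and the subsequence converges pointwise; Fatou's lemma makes its
  limit the \<open>L\<^sub>2\<close> limit of the whole sequence.\<close>

lemma L2_complete:
  assumes X: "\<And>n. square_integrable N (X n)"
    and Cauchy: "\<And>e. e > 0 \<Longrightarrow> \<exists>K. \<forall>m\<ge>K. \<forall>n\<ge>K. L2_dist_sq N (X m) (X n) < e"
  obtains X' where "square_integrable N X'" "(\<lambda>n. L2_dist_sq N (X n) X') \<longlonglongrightarrow> 0"
proof -
  have [measurable]: "X n \<in> borel_measurable N" for n using X by (simp add: square_integrable_def)
  obtain K where K: "\<And>e m n. e > 0 \<Longrightarrow> m \<ge> K e \<Longrightarrow> n \<ge> K e \<Longrightarrow> L2_dist_sq N (X m) (X n) < e"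
    using Cauchy by metis
  \<comment> \<open>The sum dominates each modulus of convergence and is monotone; the summand \<open>k\<close> makes it unbounded.\<close>
  define r where "r k = k + (\<Sum>i\<le>k. K ((1/4)^i))" for k :: nat
  have rK: "K ((1/4)^k) \<le> r k" for k
    unfolding r_def by (rule trans_le_add2, rule member_le_sum[of k "{..k}" "\<lambda>i. K ((1/4)^i)"]) auto
  have rmono: "r k \<le> r (Suc k)" for k unfolding r_def by simp
  have rk: "k \<le> r k" for k unfolding r_def by simp
  define D where "D k x = (cmod (X (r (Suc k)) x - X (r k) x))\<^sup>2" for k x
  have [measurable]: "D k \<in> borel_measurable N" for k unfolding D_def by measurable
  have Dint: "(\<integral>\<^sup>+x. ennreal (2^k * D k x) \<partial>N) \<le> ennreal ((1/2)^k)" for k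
  proof -
    have "(\<integral>\<^sup>+x. ennreal (2^k * D k x) \<partial>N) = ennreal (\<integral>x. 2^k * D k x \<partial>N)"
      by (rule nn_integral_eq_integral)
         (use square_integrable_diff[OF X X] in \<open>auto simp: square_integrable_def D_def\<close>)
    also have "(\<integral>x. 2^k * D k x \<partial>N) = 2^k * L2_dist_sq N (X (r (Suc k))) (X (r k))"
      by (simp add: D_def L2_dist_sq_def)
    also have "\<dots> \<le> 2^k * (1/4)^k"
      using K[of "(1/4)^k" "r (Suc k)" "r k"] rK[of k] rmono[of k] by simp
    also have "\<dots> = (1/2::real)^k" by (simp add: power_mult_distrib[symmetric])
    finally show ?thesis by (simp add: ennreal_leI)
  qed
  have "(\<integral>\<^sup>+x. (\<Sum>k. ennreal (2^k * D k x)) \<partial>N) = (\<Sum>k. \<integral>\<^sup>+x. ennreal (2^k * D k x) \<partial>N)"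
    by (rule nn_integral_suminf) measurable
  also have "\<dots> \<le> (\<Sum>k. ennreal ((1/2)^k))"
    by (intro suminf_le Dint) auto
  also have "\<dots> = ennreal (\<Sum>k. (1/2)^k)"
    by (intro suminf_ennreal2) auto
  finally have "(\<integral>\<^sup>+x. (\<Sum>k. ennreal (2^k * D k x)) \<partial>N) \<noteq> \<infinity>"
    using ennreal_less_top le_less_trans by (metis infinity_ennreal_def less_irrefl)
  then have "AE x in N. (\<Sum>k. ennreal (2^k * D k x)) \<noteq> \<infinity>"
    by (intro nn_integral_noteq_infinite) measurable
  then have conv: "AE x in N. (\<lambda>k. X (r k) x) \<longlonglongrightarrow> lim (\<lambda>k. X (r k) x)"
  proof (rule AE_mp, intro AE_I2 impI)
    fix x assume "(\<Sum>k. ennreal (2^k * D k x)) \<noteq> \<infinity>"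
    then have "summable (\<lambda>k. 2^k * D k x)"
      by (intro summable_suminf_not_top) (auto simp: D_def)
    then have "(\<lambda>k. 2^k * D k x) \<longlonglongrightarrow> 0" by (rule summable_LIMSEQ_zero)
    then have ev: "\<forall>\<^sub>F k in sequentially. 2^k * D k x < 1" by (rule order_tendstoD) simp
    have "summable (\<lambda>k. X (r (Suc k)) x - X (r k) x)"
    proof (rule summable_comparison_test_ev)
      show "\<forall>\<^sub>F k in sequentially. norm (X (r (Suc k)) x - X (r k) x) \<le> (sqrt (1/2))^k"
        using ev
      proof eventually_elim
        case (elim k)
        then have "D k x \<le> (1/2)^k" by (simp add: field_simps power_divide)
        then have "sqrt (D k x) \<le> sqrt ((1/2)^k)" by (rule real_sqrt_le_mono)
        then show ?case by (simp add: D_def real_sqrt_power)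
      qed
    qed (simp add: real_sqrt_divide summable_geometric)
    then have "convergent (\<lambda>n. \<Sum>k<n. X (r (Suc k)) x - X (r k) x)"
      by (simp add: summable_iff_convergent)
    then have "convergent (\<lambda>n. X (r n) x - X (r 0) x)"
      using sum_lessThan_telescope[of "\<lambda>k. X (r k) x"] by simp
    then have "convergent (\<lambda>n. X (r n) x)"
      using convergent_add[OF _ convergent_const[of "X (r 0) x"]] by fastforce
    then show "(\<lambda>k. X (r k) x) \<longlonglongrightarrow> lim (\<lambda>k. X (r k) x)"
      by (simp add: convergent_LIMSEQ_iff)
  qed
  define X' where "X' x = lim (\<lambda>k. X (r k) x)" for x
  have [measurable]: "X' \<in> borel_measurable N" unfolding X'_def by measurable
  have close: "square_integrable N (\<lambda>x. X' x - X n x) \<and> L2_dist_sq N X' (X n) \<le> e"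
    if "e > 0" "n \<ge> K e" for e n
  proof -
    have "(\<integral>\<^sup>+x. ennreal ((cmod (X' x - X n x))\<^sup>2) \<partial>N)
        = (\<integral>\<^sup>+x. liminf (\<lambda>k. ennreal ((cmod (X (r k) x - X n x))\<^sup>2)) \<partial>N)"
    proof (rule nn_integral_cong_AE, use conv in eventually_elim)
      case (elim x)
      then have "(\<lambda>k. ennreal ((cmod (X (r k) x - X n x))\<^sup>2)) \<longlonglongrightarrow> ennreal ((cmod (X' x - X n x))\<^sup>2)"
        unfolding X'_def by (intro tendsto_intros)
      then show ?case by (intro lim_imp_Liminf[symmetric]) auto
    qed
    also have "\<dots> \<le> liminf (\<lambda>k. \<integral>\<^sup>+x. ennreal ((cmod (X (r k) x - X n x))\<^sup>2) \<partial>N)"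
      by (rule nn_integral_liminf) measurable
    also have "\<dots> \<le> ennreal e"
    proof (rule Liminf_le)
      show "\<forall>\<^sub>F k in sequentially. (\<integral>\<^sup>+x. ennreal ((cmod (X (r k) x - X n x))\<^sup>2) \<partial>N) \<le> ennreal e"
        using eventually_ge_at_top[of "K e"]
      proof eventually_elim
        case (elim k)
        have "(\<integral>\<^sup>+x. ennreal ((cmod (X (r k) x - X n x))\<^sup>2) \<partial>N) = ennreal (L2_dist_sq N (X (r k)) (X n))"
          unfolding L2_dist_sq_def
          by (rule nn_integral_eq_integral)
             (use square_integrable_diff[OF X X] in \<open>auto simp: square_integrable_def\<close>)
        then show ?case
          using K[of e "r k" n] that elim rk[of k] by (simp add: ennreal_leI)
      qed
    qed simp
    finally have le: "(\<integral>\<^sup>+x. ennreal ((cmod (X' x - X n x))\<^sup>2) \<partial>N) \<le> ennreal e" .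
    have int: "integrable N (\<lambda>x. (cmod (X' x - X n x))\<^sup>2)"
      by (rule integrableI_bounded) (use le in \<open>auto simp: le_less_trans[OF _ ennreal_less_top]\<close>)
    moreover have "L2_dist_sq N X' (X n) \<le> e"
      using le nn_integral_eq_integral[OF int] \<open>e > 0\<close> by (simp add: L2_dist_sq_def)
    ultimately show ?thesis by (simp add: square_integrable_def)
  qed
  show thesis
  proof (rule that[of X'])
    show "square_integrable N X'"
      using square_integrable_add[OF conjunct1[OF close[of 1 "K 1"]] X[of "K 1"]] by simp
    show "(\<lambda>n. L2_dist_sq N (X n) X') \<longlonglongrightarrow> 0"
    proof (rule LIMSEQ_I)
      fix e :: real assume "e > 0"
      then have "\<forall>n\<ge>K (e/2). norm (L2_dist_sq N (X n) X' - 0) < e"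
        using close[of "e/2"] by (auto simp: L2_dist_sq_commute[of N "X _" X'] intro: le_less_trans[of _ "e/2"])
      then show "\<exists>no. \<forall>n\<ge>no. norm (L2_dist_sq N (X n) X' - 0) < e" by blast
    qed
  qed
qed

text \<open>Naming the finite combinations separates the approximation in \<open>closed_span\<close> from the choice of a
  finite index set and of coefficients.\<close>

definition lincombs :: "(int \<Rightarrow> 'a \<Rightarrow> complex) \<Rightarrow> int set \<Rightarrow> ('a \<Rightarrow> complex) set" where
  "lincombs e T = {\<lambda>x. \<Sum>s\<in>F. c s * e s x | F c. finite F \<and> F \<subseteq> T}"

lemma closed_span_iff:
  "X \<in> closed_span N e T \<longleftrightarrow>
     square_integrable N X \<and> (\<forall>\<epsilon>>0. \<exists>p\<in>lincombs e T. L2_dist_sq N X p < \<epsilon>)"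
proof -
  have "(\<exists>p\<in>lincombs e T. P p) \<longleftrightarrow> (\<exists>F c. finite F \<and> F \<subseteq> T \<and> P (\<lambda>x. \<Sum>s\<in>F. c s * e s x))" for P
    unfolding lincombs_def by blast
  then show ?thesis unfolding closed_span_def by simp
qed

lemma zero_in_lincombs: "(\<lambda>x. 0) \<in> lincombs e T"
  unfolding lincombs_def by (auto intro!: exI[of _ "{}"])

lemma generator_in_lincombs: "s \<in> T \<Longrightarrow> e s \<in> lincombs e T"
  unfolding lincombs_def by (auto intro!: exI[of _ "{s}"] exI[of _ "\<lambda>_. 1"])

lemma lincombs_combine:
  assumes "p \<in> lincombs e T" "q \<in> lincombs e T"
  shows "(\<lambda>x. a * p x + b * q x) \<in> lincombs e T"
proof -
  obtain F c where F: "finite F" "F \<subseteq> T" "p = (\<lambda>x. \<Sum>s\<in>F. c s * e s x)"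
    using assms(1) unfolding lincombs_def by auto
  obtain G d where G: "finite G" "G \<subseteq> T" "q = (\<lambda>x. \<Sum>s\<in>G. d s * e s x)"
    using assms(2) unfolding lincombs_def by auto
  let ?h = "\<lambda>s. (if s \<in> F then a * c s else 0) + (if s \<in> G then b * d s else 0)"
  have "a * p x + b * q x = (\<Sum>s\<in>F \<union> G. ?h s * e s x)" for x
  proof -
    have "(\<Sum>s\<in>F \<union> G. ?h s * e s x)
        = (\<Sum>s\<in>F \<union> G. if s \<in> F then a * c s * e s x else 0) + (\<Sum>s\<in>F \<union> G. if s \<in> G then b * d s * e s x else 0)"
      unfolding sum.distrib[symmetric] by (intro sum.cong) (auto simp: distrib_right)
    also have "(\<Sum>s\<in>F \<union> G. if s \<in> F then a * c s * e s x else 0) = (\<Sum>s\<in>F. a * c s * e s x)"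
      using F(1) G(1) by (simp add: sum.inter_restrict[symmetric] Int_absorb1)
    also have "(\<Sum>s\<in>F \<union> G. if s \<in> G then b * d s * e s x else 0) = (\<Sum>s\<in>G. b * d s * e s x)"
      using F(1) G(1) by (simp add: sum.inter_restrict[symmetric] Int_absorb1)
    finally show ?thesis by (simp add: F(3) G(3) sum_distrib_left mult.assoc)
  qed
  then show ?thesis
    unfolding lincombs_def using F(1,2) G(1,2) by (auto intro!: exI[of _ "F \<union> G"] exI[of _ ?h])
qed

lemma square_integrable_lincombs:
  assumes "\<And>s. s \<in> T \<Longrightarrow> square_integrable N (e s)" "p \<in> lincombs e T"
  shows "square_integrable N p"
  using assms unfolding lincombs_def by (auto intro!: square_integrable_lincomb)

lemma ip_lincombs_eq_0:
  assumes "\<And>s. s \<in> T \<Longrightarrow> square_integrable N (e s)" "square_integrable N r"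
    and "\<And>s. s \<in> T \<Longrightarrow> ip N r (e s) = 0" "p \<in> lincombs e T"
  shows "ip N p r = 0"
proof -
  obtain F c where F: "finite F" "F \<subseteq> T" "p = (\<lambda>x. \<Sum>s\<in>F. c s * e s x)"
    using assms(4) unfolding lincombs_def by auto
  have "ip N p r = (\<Sum>s\<in>F. c s * ip N (e s) r)"
    using ip_lincomb[of F N e "{()}" "\<lambda>_. r" c "\<lambda>_. 1"] assms(1,2) F(2)
    by (auto simp: F(3))
  also have "\<dots> = 0"
    using assms(3) F(2) ip_cnj[of N r] by (intro sum.neutral) (metis complex_cnj_zero mult_zero_right subsetD)
  finally show ?thesis .
qed

text \<open>By Cauchy-Schwarz an inner product that vanishes on the combinations vanishes on their limits.\<close>

lemma ip_closed_span_eq_0: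
  assumes e: "\<And>s. s \<in> T \<Longrightarrow> square_integrable N (e s)" and r: "square_integrable N r"
    and orth: "\<And>s. s \<in> T \<Longrightarrow> ip N r (e s) = 0" and X: "X \<in> closed_span N e T"
  shows "ip N X r = 0"
proof (rule ccontr)
  assume ne: "ip N X r \<noteq> 0"
  let ?R = "\<integral>x. (cmod (r x))\<^sup>2 \<partial>N"
  have sX: "square_integrable N X" using X by (simp add: closed_span_iff)
  have R: "?R + 1 > 0" by (rule add_nonneg_pos) auto
  then obtain p where p: "p \<in> lincombs e T" "L2_dist_sq N X p < (cmod (ip N X r))\<^sup>2 / (?R + 1)"
    using X ne unfolding closed_span_iff by (meson divide_pos_pos zero_less_norm_iff zero_less_power)
  have sp: "square_integrable N p" using square_integrable_lincombs[OF e p(1)] .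
  have "ip N (\<lambda>x. X x - p x) r = ip N X r"
    using ip_lincombs_eq_0[OF e r orth p(1)] by (simp add: ip_diff_left sX sp r)
  then have "(cmod (ip N X r))\<^sup>2 \<le> L2_dist_sq N X p * ?R"
    using Cauchy_Schwarz_ip[OF square_integrable_diff[OF sX sp] r] by (simp add: L2_dist_sq_def)
  also have "\<dots> \<le> L2_dist_sq N X p * (?R + 1)" by (intro mult_left_mono) auto
  also have "\<dots> < (cmod (ip N X r))\<^sup>2" using p(2) R by (simp add: pos_less_divide_eq)
  finally show False by simp
qed

text \<open>The residual \<open>r = X - q\<close> of the best approximation \<open>q\<close>, which exists by completeness, is
  orthogonal to the generators, hence to \<open>q\<close> and by hypothesis to \<open>X\<close>, so \<open>r = 0\<close>.\<close>

lemma closed_span_if_orthogonal: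
  assumes e: "\<And>s. s \<in> T \<Longrightarrow> square_integrable N (e s)" and X: "square_integrable N X"
    and orth: "\<And>r. square_integrable N r \<Longrightarrow> (\<And>s. s \<in> T \<Longrightarrow> ip N r (e s) = 0) \<Longrightarrow> ip N X r = 0"
  shows "X \<in> closed_span N e T"
proof -
  let ?V = "lincombs e T"
  define d where "d = (INF p\<in>?V. L2_dist_sq N X p)"
  have bdd: "bdd_below (L2_dist_sq N X ` ?V)" by (intro bdd_belowI2[of _ 0]) simp
  have d_le: "d \<le> L2_dist_sq N X p" if "p \<in> ?V" for p
    unfolding d_def using bdd that by (rule cINF_lower)
  have "\<exists>p\<in>?V. L2_dist_sq N X p < d + 1 / Suc n" for n
  proof -
    have "Inf (L2_dist_sq N X ` ?V) < d + 1 / Suc n" unfolding d_def by simp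
    then show ?thesis using cInf_lessD[of "L2_dist_sq N X ` ?V"] zero_in_lincombs by blast
  qed
  then obtain p where p: "\<And>n. p n \<in> ?V" "\<And>n. L2_dist_sq N X (p n) < d + 1 / Suc n" by metis
  have sp: "square_integrable N (p n)" for n using square_integrable_lincombs[OF e p(1)] .
  \<comment> \<open>The midpoint of two nearly optimal combinations is no better than optimal, so they are close.\<close>
  have parallelogram: "L2_dist_sq N (p m) (p n) \<le> 2 / Suc m + 2 / Suc n" for m n
  proof -
    let ?q = "\<lambda>x. (1/2) * p m x + (1/2) * p n x"
    have qV: "?q \<in> ?V" by (intro lincombs_combine p)
    have sq: "square_integrable N ?q" using square_integrable_lincombs[OF e qV] .
    have pt: "(cmod (p m x - p n x))\<^sup>2 + 4 * (cmod (X x - ?q x))\<^sup>2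
        = 2 * (cmod (X x - p m x))\<^sup>2 + 2 * (cmod (X x - p n x))\<^sup>2" for x
      unfolding cmod_power2 by (simp add: power2_eq_square field_simps)
    have ints: "integrable N (\<lambda>x. (cmod (p m x - p n x))\<^sup>2)" "integrable N (\<lambda>x. (cmod (X x - ?q x))\<^sup>2)"
      "integrable N (\<lambda>x. (cmod (X x - p m x))\<^sup>2)" "integrable N (\<lambda>x. (cmod (X x - p n x))\<^sup>2)"
      using square_integrable_diff sp sq X by (metis square_integrable_def)+
    have "L2_dist_sq N (p m) (p n) + 4 * L2_dist_sq N X ?q
        = (\<integral>x. (cmod (p m x - p n x))\<^sup>2 + 4 * (cmod (X x - ?q x))\<^sup>2 \<partial>N)"
      unfolding L2_dist_sq_def using ints(1,2) by simp
    also have "\<dots> = 2 * L2_dist_sq N X (p m) + 2 * L2_dist_sq N X (p n)"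
      unfolding pt L2_dist_sq_def using ints(3,4) by simp
    finally show ?thesis using d_le[OF qV] p(2)[of m] p(2)[of n] by simp
  qed
  have inv: "(\<lambda>n. 1 / real (Suc n)) \<longlonglongrightarrow> 0" using LIMSEQ_Suc[OF lim_1_over_n[where 'a = real]] . 
  have "\<exists>K. \<forall>m\<ge>K. \<forall>n\<ge>K. L2_dist_sq N (p m) (p n) < \<epsilon>" if "\<epsilon> > 0" for \<epsilon>
  proof -
    have "\<epsilon> / 4 > 0" using that by simp
    then obtain K where K: "1 / real (Suc K) < \<epsilon> / 4" by (rule nat_approx_posE)
    have "L2_dist_sq N (p m) (p n) < \<epsilon>" if "m \<ge> K" "n \<ge> K" for m n
    proof -
      have "1 / real (Suc m) \<le> 1 / real (Suc K)" "1 / real (Suc n) \<le> 1 / real (Suc K)"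
        using that by (auto intro!: divide_left_mono)
      then show ?thesis using parallelogram[of m n] K by linarith
    qed
    then show ?thesis by blast
  qed
  then obtain q where q: "square_integrable N q" "(\<lambda>n. L2_dist_sq N (p n) q) \<longlonglongrightarrow> 0"
    using L2_complete[of N p] sp by blast
  define r where "r x = X x - q x" for x
  define rn where "rn n x = X x - p n x" for n x
  have sr: "square_integrable N r" and srn: "square_integrable N (rn n)" for n
    unfolding r_def rn_def using X q(1) sp by (auto intro: square_integrable_diff)
  have rlim: "(\<lambda>n. L2_dist_sq N (rn n) r) \<longlonglongrightarrow> 0"
    using q(2) by (simp add: L2_dist_sq_def r_def rn_def norm_minus_commute)
  have rY: "(\<lambda>n. L2_dist_sq N (rn n) Y) \<longlonglongrightarrow> L2_dist_sq N r Y" if "square_integrable N Y" for Y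
    using srn sr that rlim by (rule L2_dist_sq_tendsto)
  have d_eq: "L2_dist_sq N r (\<lambda>x. 0) = d"
  proof (rule LIMSEQ_unique[OF rY])
    show "(\<lambda>n. L2_dist_sq N (rn n) (\<lambda>x. 0)) \<longlonglongrightarrow> d"
    proof (rule tendsto_sandwich[OF _ _ tendsto_const[of d]])
      show "(\<lambda>n. d + 1 / real (Suc n)) \<longlonglongrightarrow> d" using tendsto_add[OF tendsto_const inv] by simp
      show "\<forall>\<^sub>F n in sequentially. L2_dist_sq N (rn n) (\<lambda>x. 0) \<le> d + 1 / real (Suc n)"
        using p(2) by (auto simp: L2_dist_sq_def rn_def intro!: always_eventually less_imp_le)
      show "\<forall>\<^sub>F n in sequentially. d \<le> L2_dist_sq N (rn n) (\<lambda>x. 0)"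
        using d_le[OF p(1)] by (auto simp: L2_dist_sq_def rn_def)
    qed
  qed simp
  have r_orth: "ip N r (e s) = 0" if s: "s \<in> T" for s
  proof (rule ccontr)
    assume ne: "ip N r (e s) \<noteq> 0"
    let ?w = "ip N r (e s)" and ?E = "\<integral>x. (cmod (e s x))\<^sup>2 \<partial>N"
    have E: "?E \<ge> 0" by simp
    \<comment> \<open>Moving from \<open>q\<close> a small step in the direction of \<open>?w * e s\<close> would shorten the residual.\<close>
    define t :: real where "t = 1 / (?E + 1)"
    let ?z = "of_real t * ?w"
    have sz: "square_integrable N (\<lambda>x. ?z * e s x)" using e[OF s] by (rule square_integrable_cmult)
    have "d \<le> L2_dist_sq N r (\<lambda>x. ?z * e s x)"
    proof (rule LIMSEQ_le_const[OF rY[OF sz]], intro exI allI impI)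
      fix n
      have "(\<lambda>x. 1 * p n x + ?z * e s x) \<in> ?V" by (intro lincombs_combine p generator_in_lincombs s)
      from d_le[OF this] show "d \<le> L2_dist_sq N (rn n) (\<lambda>x. ?z * e s x)"
        by (simp add: L2_dist_sq_def rn_def algebra_simps)
    qed
    also have "\<dots> = d - 2 * t * (cmod ?w)\<^sup>2 + t\<^sup>2 * (cmod ?w)\<^sup>2 * ?E"
    proof -
      have ww: "?w * cnj ?w = of_real ((cmod ?w)\<^sup>2)" by (rule complex_norm_square[symmetric])
      have "ip N r (\<lambda>x. ?z * e s x) = of_real t * (?w * cnj ?w)"
        unfolding ip_cmult_right by simp
      moreover have "ip N (\<lambda>x. ?z * e s x) r = of_real t * (?w * cnj ?w)"
        unfolding ip_cmult_left ip_cnj by simp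
      moreover have "ip N (\<lambda>x. ?z * e s x) (\<lambda>x. ?z * e s x) = of_real (t\<^sup>2 * (cmod ?w)\<^sup>2 * ?E)"
        unfolding ip_self by (simp add: norm_mult power_mult_distrib)
      moreover have "ip N r r = of_real d"
        using d_eq by (simp add: ip_self L2_dist_sq_def)
      ultimately show ?thesis
        unfolding L2_dist_sq_ip[OF sr sz] ww of_real_mult[symmetric] of_real_diff[symmetric]
          of_real_add[symmetric] Re_complex_of_real by simp
    qed
    finally have "0 \<le> (t * (cmod ?w)\<^sup>2) * (t * ?E - 2)" by (simp add: power2_eq_square algebra_simps)
    moreover have "t * (cmod ?w)\<^sup>2 > 0"
      using ne add_nonneg_pos[OF E zero_less_one] by (simp add: t_def)
    moreover have "t * ?E \<le> 1" using E add_nonneg_pos[OF E zero_less_one] by (simp add: t_def divide_le_eq_1)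
    ultimately show False by (auto simp: zero_le_mult_iff)
  qed
  have "ip N (p n) r = 0" for n
    by (rule ip_lincombs_eq_0[OF e sr r_orth p(1)])
  moreover have "(\<lambda>n. ip N (p n) r) \<longlonglongrightarrow> ip N q r"
    using sp q(1) sr sr q(2) by (rule ip_tendsto) (simp add: L2_dist_sq_def)
  ultimately have "ip N q r = 0" by (simp add: LIMSEQ_const_iff)
  moreover have "ip N X r = 0" using orth[OF sr r_orth] .
  ultimately have "ip N r r = 0" using ip_diff_left[OF X q(1) sr] by (simp add: r_def[abs_def])
  then have "d = 0" using d_eq by (simp add: ip_self L2_dist_sq_def)
  show ?thesis
    unfolding closed_span_iff
  proof (intro conjI X allI impI)
    fix \<epsilon> :: real assume "\<epsilon> > 0"
    then obtain n where "1 / real (Suc n) < \<epsilon>" by (rule nat_approx_posE)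
    then show "\<exists>p\<in>?V. L2_dist_sq N X p < \<epsilon>"
      using p(1)[of n] p(2)[of n] \<open>d = 0\<close> by (intro bexI[of _ "p n"]) auto
  qed
qed

section \<open>Uniqueness of Fourier coefficients\<close>

text \<open>An inductive description gives closure under products and the vanishing of integrals by plain
  rule induction, without bookkeeping of frequency sets.\<close>

inductive trig_poly :: "(real \<Rightarrow> complex) \<Rightarrow> bool" where
  monomial: "trig_poly (\<lambda>u. c * cis (of_int s * u))"
| sum: "trig_poly p \<Longrightarrow> trig_poly q \<Longrightarrow> trig_poly (\<lambda>u. p u + q u)"

lemma trig_poly_const: "trig_poly (\<lambda>u. c)"
  using trig_poly.monomial[of c 0] by simp

lemma trig_poly_mult:
  assumes "trig_poly p" "trig_poly q"
  shows "trig_poly (\<lambda>u. p u * q u)"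
  using assms(1)
proof induction
  case (monomial c s)
  show ?case
    using assms(2)
  proof induction
    case (monomial d t)
    have "c * cis (of_int s * u) * (d * cis (of_int t * u)) = (c * d) * cis (of_int (s + t) * u)" for u
      by (simp add: cis_mult distrib_left distrib_right mult_ac)
    then show ?case by (simp only: trig_poly.monomial)
  next
    case (sum p q)
    then show ?case by (simp add: distrib_left trig_poly.sum)
  qed
next
  case (sum p q)
  then show ?case by (simp add: distrib_right trig_poly.sum)
qed

lemma trig_poly_real_polynomial_cis:
  fixes p :: "complex \<Rightarrow> real"
  assumes "real_polynomial_function p"
  shows "trig_poly (\<lambda>u. of_real (p (cis u)))"
  using assms
proof induction
  case (linear h)
  then interpret bounded_linear h .
  have "h (cis u) = cos u * h 1 + sin u * h \<i>" for u
  proof -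
    have "cis u = cos u *\<^sub>R 1 + sin u *\<^sub>R \<i>" by (simp add: complex_eq_iff)
    then show ?thesis by (simp only: add scaleR) simp
  qed
  then have "complex_of_real (h (cis u)) = Complex (h 1 / 2) (- h \<i> / 2) * cis (of_int 1 * u)
      + Complex (h 1 / 2) (h \<i> / 2) * cis (of_int (-1) * u)" for u
    by (simp add: complex_eq_iff)
  then show ?case by (simp only: trig_poly.intros)
next
  case (const c)
  show ?case by (rule trig_poly_const)
next
  case (add f g)
  then show ?case by (simp add: trig_poly.sum)
next
  case (mult f g)
  then show ?case by (simp add: trig_poly_mult)
qed

lemma trig_poly_bounded: "trig_poly p \<Longrightarrow> p \<in> borel_measurable borel \<and> (\<exists>b. \<forall>u. cmod (p u) \<le> b)"
proof (induction rule: trig_poly.induct)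
  case (monomial c s)
  have "continuous_on UNIV (\<lambda>u. c * cis (of_int s * u))" by (intro continuous_intros)
  then show ?case by (auto simp: norm_mult intro: borel_measurable_continuous_onI)
next
  case (sum p q)
  then obtain a b where "\<forall>u. cmod (p u) \<le> a" "\<forall>u. cmod (q u) \<le> b" by blast
  then have "\<forall>u. cmod (p u + q u) \<le> a + b" by (meson add_mono norm_triangle_ineq order_trans)
  then show ?case using sum by auto
qed

lemma integrable_mult_bounded:
  fixes g h :: "'a \<Rightarrow> complex"
  assumes "integrable N g" "h \<in> borel_measurable N" "\<And>x. x \<in> space N \<Longrightarrow> cmod (h x) \<le> b"
  shows "integrable N (\<lambda>x. g x * h x)"
proof (rule Bochner_Integration.integrable_bound)
  show "integrable N (\<lambda>x. b * cmod (g x))" using assms(1) by simp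
  show "AE x in N. norm (g x * h x) \<le> norm (b * cmod (g x))"
  proof (intro AE_I2)
    fix x assume "x \<in> space N"
    then have "cmod (h x) \<le> \<bar>b\<bar>" using assms(3) by force
    then show "norm (g x * h x) \<le> norm (b * cmod (g x))"
      using mult_right_mono[of "cmod (h x)" "\<bar>b\<bar>" "cmod (g x)"]
      by (simp add: norm_mult abs_mult mult.commute)
  qed
qed (use assms in simp)

lemma finite_measure_leb_circle: "finite_measure leb_circle"
  by (intro finite_measureI) (simp add: space_restrict_space emeasure_restrict_space)

text \<open>Polynomials in the real coordinates are dense in the continuous functions on the unit circle,
  and restricted to it they are trigonometric polynomials. Bounded limits then give indicators of
  open sets, Dynkin's lemma those of Borel sets, and as the angle is a Borel function of the point
  on the circle these determine the integral of \<open>g\<close> over every Borel set of angles.\<close>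

lemma AE_zero_if_Fourier_coefficients_zero:
  fixes g :: "real \<Rightarrow> complex"
  assumes g: "integrable leb_circle g"
    and zero: "\<And>s::int. (\<integral>u. g u * cis (of_int s * u) \<partial>leb_circle) = 0"
  shows "AE u in leb_circle. g u = 0"
proof -
  interpret finite_measure leb_circle by (rule finite_measure_leb_circle)
  let ?N = leb_circle
  have mb: "(\<lambda>u. h (cis u)) \<in> borel_measurable ?N" if "h \<in> borel_measurable borel" for h :: "complex \<Rightarrow> complex"
  proof -
    have "cis \<in> borel_measurable borel" by (intro borel_measurable_continuous_onI continuous_intros)
    then have "(\<lambda>u. h (cis u)) \<in> borel_measurable lborel"
      using that by (auto intro: measurable_compose)
    then show ?thesis by (rule measurable_restrict_space1)
  qed
  have pm: "p \<in> borel_measurable ?N" if "trig_poly p" for p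
    using trig_poly_bounded[OF that] by (intro measurable_restrict_space1) simp
  have pint: "integrable ?N (\<lambda>u. g u * p u)" if "trig_poly p" for p
    using trig_poly_bounded[OF that] pm[OF that] g by (auto intro: integrable_mult_bounded)
  have trig: "(\<integral>u. g u * p u \<partial>?N) = 0" if "trig_poly p" for p
    using that
  proof induction
    case (monomial c s)
    have "(\<integral>u. g u * (c * cis (of_int s * u)) \<partial>?N) = c * (\<integral>u. g u * cis (of_int s * u) \<partial>?N)"
      by (simp add: mult.left_commute)
    then show ?case using zero by simp
  next
    case (sum p q)
    then show ?case using pint by (simp add: distrib_left)
  qed
  have cont: "(\<integral>u. g u * of_real (H (cis u)) \<partial>?N) = 0" if H: "continuous_on UNIV H" for H :: "complex \<Rightarrow> real"
  proof -
    have "compact (H ` sphere 0 1)"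
      by (intro compact_continuous_image continuous_on_subset[OF H]) auto
    then obtain b where b: "\<And>z. z \<in> sphere 0 1 \<Longrightarrow> norm (H z) \<le> b"
      using compact_imp_bounded bounded_iff by (metis imageI)
    have Hm: "(\<lambda>u. complex_of_real (H (cis u))) \<in> borel_measurable ?N"
      by (rule mb) (intro borel_measurable_continuous_onI continuous_on_of_real H)
    have Hint: "integrable ?N (\<lambda>u. g u * of_real (H (cis u)))"
      by (rule integrable_mult_bounded[OF g Hm, of b]) (use b in auto)
    let ?G = "\<integral>u. cmod (g u) \<partial>?N"
    have G: "?G \<ge> 0" by simp
    have le: "cmod (\<integral>u. g u * of_real (H (cis u)) \<partial>?N) \<le> e * ?G" if "e > 0" for e
    proof -
      obtain p where p: "real_polynomial_function p" "\<And>z. z \<in> sphere 0 1 \<Longrightarrow> \<bar>H z - p z\<bar> < e"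
        using Stone_Weierstrass_real_polynomial_function[OF compact_sphere continuous_on_subset[OF H] \<open>e > 0\<close>]
        by blast
      note tp = trig_poly_real_polynomial_cis[OF p(1)]
      have "(\<integral>u. g u * of_real (H (cis u)) \<partial>?N) = (\<integral>u. g u * of_real (H (cis u)) - g u * of_real (p (cis u)) \<partial>?N)"
        using trig[OF tp] Hint pint[OF tp] by simp
      also have "cmod \<dots> \<le> (\<integral>u. e * cmod (g u) \<partial>?N)"
      proof (rule order_trans[OF Bochner_Integration.integral_norm_bound integral_mono])
        fix u
        have "cmod (g u * of_real (H (cis u)) - g u * of_real (p (cis u))) = cmod (g u) * \<bar>H (cis u) - p (cis u)\<bar>"
          by (simp add: right_diff_distrib[symmetric] norm_mult of_real_diff[symmetric] del: of_real_diff)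
        also have "\<dots> \<le> cmod (g u) * e" using p(2)[of "cis u"] by (intro mult_left_mono) auto
        finally show "cmod (g u * of_real (H (cis u)) - g u * of_real (p (cis u))) \<le> e * cmod (g u)"
          by (simp add: mult.commute)
      qed (use Hint pint[OF tp] g in auto)
      finally show ?thesis by simp
    qed
    have "cmod (\<integral>u. g u * of_real (H (cis u)) \<partial>?N) \<le> 0"
    proof (rule field_le_epsilon)
      fix e :: real assume "e > 0"
      moreover have "?G + 1 > 0" using G by (rule add_nonneg_pos) simp
      ultimately have "e / (?G + 1) * ?G \<le> e" by (simp add: field_simps)
      then show "cmod (\<integral>u. g u * of_real (H (cis u)) \<partial>?N) \<le> 0 + e"
        using le[of "e / (?G + 1)"] \<open>?G + 1 > 0\<close> \<open>e > 0\<close> by simp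
    qed
    then show ?thesis by simp
  qed
  have total: "(\<integral>u. g u \<partial>?N) = 0" using zero[of 0] by simp
  have "open": "(\<integral>u. g u * indicator U (cis u) \<partial>?N) = 0" if U: "open U" for U
  proof (cases "U = UNIV")
    case True then show ?thesis using total by simp
  next
    case False
    \<comment> \<open>Continuous functions increasing to the indicator of \<open>U\<close>; the distance to the complement is positive exactly on \<open>U\<close>.\<close>
    define H where "H n z = min 1 (real n * infdist z (- U))" for n z
    have H01: "0 \<le> H n z" "H n z \<le> 1" for n z unfolding H_def by (auto simp: infdist_nonneg)
    have Hc: "continuous_on UNIV (H n)" for n unfolding H_def by (intro continuous_intros)
    have lim: "(\<lambda>n. H n z) \<longlonglongrightarrow> indicator U z" for z
    proof (cases "z \<in> U")
      case True
      have pos: "infdist z (- U) > 0"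
        using U True False by (intro infdist_pos_not_in_closed) auto
      obtain k :: nat where k: "1 / infdist z (- U) \<le> real k" using real_arch_simple by blast
      have "\<forall>\<^sub>F n in sequentially. H n z = indicator U z"
        using eventually_ge_at_top[of k]
      proof eventually_elim
        case (elim n)
        then have "1 / infdist z (- U) \<le> real n" using k by linarith
        then show ?case using True pos by (simp add: H_def field_simps)
      qed
      then show ?thesis by (rule tendsto_eventually)
    qed (simp add: H_def)
    have limC: "(\<lambda>n. complex_of_real (H n z)) \<longlonglongrightarrow> indicator U z" for z
      using tendsto_of_real[OF lim[of z], where 'a = complex] by (cases "z \<in> U") simp_all
    have "(\<lambda>n. \<integral>u. g u * of_real (H n (cis u)) \<partial>?N) \<longlonglongrightarrow> (\<integral>u. g u * indicator U (cis u) \<partial>?N)"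
    proof (rule integral_dominated_convergence)
      show "(\<lambda>u. g u * indicator U (cis u)) \<in> borel_measurable ?N"
        using g U by (intro borel_measurable_times mb borel_measurable_indicator) auto
      show "(\<lambda>u. g u * of_real (H n (cis u))) \<in> borel_measurable ?N" for n
        using g by (intro borel_measurable_times mb borel_measurable_continuous_onI continuous_on_of_real Hc) auto
      show "integrable ?N (\<lambda>u. cmod (g u))" using g by simp
      show "AE u in ?N. (\<lambda>n. g u * of_real (H n (cis u))) \<longlonglongrightarrow> g u * indicator U (cis u)"
        by (intro AE_I2 tendsto_mult tendsto_const limC)
      show "AE u in ?N. norm (g u * of_real (H n (cis u))) \<le> cmod (g u)" for n
        using H01 by (intro AE_I2) (simp add: norm_mult mult_left_le)
    qed
    then show ?thesis using cont[OF Hc] by (simp add: LIMSEQ_const_iff)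
  qed
  have iint: "integrable ?N (\<lambda>u. g u * indicator A (cis u))" if "A \<in> sets borel" for A :: "complex set"
    by (rule integrable_mult_bounded[OF g mb, of _ 1])
       (use that in \<open>auto simp: indicator_def\<close>)
  have borel: "(\<integral>u. g u * indicator A (cis u) \<partial>?N) = 0" if A: "A \<in> sets borel" for A :: "complex set"
  proof -
    have sb: "sets (borel :: complex measure) = sigma_sets UNIV {S. open S}" by (rule sets_borel)
    have "Int_stable {S :: complex set. open S}" by (auto intro: Int_stableI)
    moreover have "{S :: complex set. open S} \<subseteq> Pow UNIV" by simp
    moreover have "A \<in> sigma_sets UNIV {S. open S}" using A by (simp add: sb)
    ultimately show ?thesis
    proof (induction rule: sigma_sets_induct_disjoint)
      case (basic A) then show ?case using "open" by simp
    next
      case empty then show ?case by simp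
    next
      case (compl A)
      have "g u * indicator (UNIV - A) (cis u) = g u - g u * indicator A (cis u)" for u
        by (simp add: indicator_def)
      then show ?case using compl iint[of A] g total by (simp add: sb)
    next
      case (union A)
      have Am: "A i \<in> sets borel" for i using union(2) by (auto simp: sb)
      have "(\<lambda>n. \<integral>u. (\<Sum>i<n. g u * indicator (A i) (cis u)) \<partial>?N) \<longlonglongrightarrow> (\<integral>u. g u * indicator (\<Union>i. A i) (cis u) \<partial>?N)"
      proof (rule integral_dominated_convergence)
        show "(\<lambda>u. g u * indicator (\<Union>i. A i) (cis u)) \<in> borel_measurable ?N"
          using iint[of "\<Union>i. A i"] Am by auto
        show "(\<lambda>u. \<Sum>i<n. g u * indicator (A i) (cis u)) \<in> borel_measurable ?N" for n
          using iint[OF Am] by (intro borel_measurable_sum) auto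
        show "integrable ?N (\<lambda>u. cmod (g u))" using g by simp
        show "AE u in ?N. (\<lambda>n. \<Sum>i<n. g u * indicator (A i) (cis u)) \<longlonglongrightarrow> g u * indicator (\<Union>i. A i) (cis u)"
        proof (intro AE_I2)
          fix u
          have "(\<lambda>i. indicat_real (A i) (cis u)) sums indicat_real (\<Union>i. A i) (cis u)"
            using union(1) by (intro indicator_sums) (auto simp: disjoint_family_on_def)
          then have "(\<lambda>i. g u * of_real (indicat_real (A i) (cis u))) sums (g u * of_real (indicat_real (\<Union>i. A i) (cis u)))"
            by (intro sums_mult sums_of_real)
          then show "(\<lambda>n. \<Sum>i<n. g u * indicator (A i) (cis u)) \<longlonglongrightarrow> g u * indicator (\<Union>i. A i) (cis u)"
            unfolding of_real_indicator sums_def .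
        qed
        show "AE u in ?N. norm (\<Sum>i<n. g u * indicator (A i) (cis u)) \<le> cmod (g u)" for n
        proof (intro AE_I2)
          fix u
          have "(\<Sum>i<n. g u * indicator (A i) (cis u)) = g u * indicator (\<Union>i<n. A i) (cis u)"
            using union(1) by (subst indicator_UN_disjoint)
              (auto simp: sum_distrib_left intro: disjoint_family_on_mono)
          then show "norm (\<Sum>i<n. g u * indicator (A i) (cis u)) \<le> cmod (g u)"
            by (simp only: norm_mult) (simp split: split_indicator)
        qed
      qed
      moreover have "(\<integral>u. (\<Sum>i<n. g u * indicator (A i) (cis u)) \<partial>?N) = 0" for n
        using union(3) iint[OF Am] by (subst Bochner_Integration.integral_sum) simp_all
      ultimately show ?case by (simp add: LIMSEQ_const_iff)
    qed
  qed
  show ?thesis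
  proof (rule density_zero[OF g])
    fix S assume S: "S \<in> sets ?N"
    have Sb: "S \<in> sets borel" using S by (auto simp: sets_restrict_space)
    \<comment> \<open>The principal argument recovers the angle except at \<open>- pi\<close>, where it returns \<open>pi\<close>.\<close>
    define A where "A = {z. z \<noteq> 0 \<and> Im (Ln z) \<in> S}"
    have Ab: "A \<in> sets borel"
      unfolding A_def using Sb by measurable
    have ne: "AE u in ?N. u \<noteq> - pi"
    proof -
      have "AE u in lborel. u \<noteq> - pi" by (rule AE_lborel_singleton)
      then show ?thesis by (subst AE_restrict_space_iff) auto
    qed
    have "set_lebesgue_integral ?N S g = (\<integral>u. g u * indicator A (cis u) \<partial>?N)"
      unfolding set_lebesgue_integral_def
    proof (rule integral_cong_AE)
      show "AE u in ?N. indicat_real S u *\<^sub>R g u = g u * indicator A (cis u)"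
        using ne AE_space
      proof eventually_elim
        case (elim u)
        then have "Arg (cis u) = u" by (intro cis_Arg_unique) (auto simp: sgn_div_norm)
        then have "Im (Ln (cis u)) = u" using Arg_eq_Im_Ln[of "cis u"] by simp
        then show ?case by (simp add: A_def indicator_def)
      qed
    qed (use g S iint[OF Ab] in auto)
    then show "set_lebesgue_integral ?N S g = 0" using borel[OF Ab] by simp
  qed
qed

lemma measure_leb_circle: "measure leb_circle {-pi..<pi} = 2 * pi"
  by (simp add: measure_restrict_space)

lemma integral_cis_leb_circle:
  assumes "s \<noteq> 0"
  shows "(\<integral>u. cis (of_int s * u) \<partial>leb_circle) = 0"
proof -
  let ?F = "\<lambda>u. cis (of_int s * u) / (\<i> * of_int s)"
  have "(\<integral>u. cis (of_int s * u) \<partial>leb_circle) = (\<integral>u. indicator {-pi..<pi} u *\<^sub>R cis (of_int s * u) \<partial>lborel)"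
    by (rule integral_restrict_space) simp
  also have "\<dots> = (\<integral>u. indicator {-pi..pi} u *\<^sub>R cis (of_int s * u) \<partial>lborel)"
  proof (rule integral_cong_AE)
    have c: "(\<lambda>u. cis (of_int s * u)) \<in> borel_measurable lborel"
      by (simp, intro borel_measurable_continuous_onI continuous_intros)
    show "(\<lambda>u. indicat_real {-pi..<pi} u *\<^sub>R cis (of_int s * u)) \<in> borel_measurable lborel"
      "(\<lambda>u. indicat_real {-pi..pi} u *\<^sub>R cis (of_int s * u)) \<in> borel_measurable lborel"
      using c by (auto intro!: borel_measurable_scaleR)
    show "AE u in lborel. indicat_real {-pi..<pi} u *\<^sub>R cis (of_int s * u) = indicat_real {-pi..pi} u *\<^sub>R cis (of_int s * u)"
      using AE_lborel_singleton[of pi] by eventually_elim (auto simp: indicator_def)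
  qed
  also have "\<dots> = ?F pi - ?F (-pi)"
  proof (rule integral_FTC_atLeastAtMost)
    show "(?F has_vector_derivative cis (of_int s * x)) (at x within {-pi..pi})" for x
      unfolding cis_conv_exp
      by (auto intro!: derivative_eq_intros has_vector_derivative_real_field simp: assms mult_ac)
  qed (auto intro!: continuous_intros)
  also have "\<dots> = 0"
  proof -
    have "cis (of_int s * pi) = cis (- (of_int s * pi)) * cis (of_int s * (2 * pi))"
      by (simp add: cis_mult algebra_simps)
    also have "cis (of_int s * (2 * pi)) = 1"
      using cis_multiple_2pi[of "of_int s"] by (simp add: mult_ac)
    finally show ?thesis by simp
  qed
  finally show ?thesis .
qed

text \<open>Subtracting the mean of \<open>g\<close> removes its remaining Fourier coefficient.\<close>

corollary AE_constant_if_nonzero_Fourier_coefficients_zero: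
  fixes g :: "real \<Rightarrow> complex"
  assumes g: "integrable leb_circle g"
    and zero: "\<And>s::int. s \<noteq> 0 \<Longrightarrow> (\<integral>u. g u * cis (of_int s * u) \<partial>leb_circle) = 0"
  obtains c where "AE u in leb_circle. g u = c"
proof -
  interpret finite_measure leb_circle by (rule finite_measure_leb_circle)
  define c where "c = (\<integral>u. g u \<partial>leb_circle) / (2 * pi)"
  have m: "(\<lambda>u. cis (of_int s * u)) \<in> borel_measurable leb_circle" for s :: int
    by (intro measurable_restrict_space1) (simp, intro borel_measurable_continuous_onI continuous_intros)
  have cis: "integrable leb_circle (\<lambda>u. c * cis (of_int s * u))" for s :: int
    by (rule integrable_mult_bounded[OF _ m, of "\<lambda>_. c" _ 1]) auto
  have gcis: "integrable leb_circle (\<lambda>u. g u * cis (of_int s * u))" for s :: int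
    by (rule integrable_mult_bounded[OF g m, of _ 1]) auto
  have "AE u in leb_circle. g u - c = 0"
  proof (rule AE_zero_if_Fourier_coefficients_zero)
    show "(\<integral>u. (g u - c) * cis (of_int s * u) \<partial>leb_circle) = 0" for s
    proof (cases "s = 0")
      case True
      then show ?thesis
        using g by (simp add: c_def measure_leb_circle space_restrict_space scaleR_conv_of_real)
    next
      case False
      then show ?thesis using zero integral_cis_leb_circle cis gcis by (simp add: left_diff_distrib)
    qed
  qed (use g in simp)
  then show thesis by (intro that[of c]) simp
qed

section \<open>The stochastic integral as an isometry\<close>

lemma simple_function_lincomb:
  fixes \<psi> :: "'a \<Rightarrow> complex"
  assumes "simple_function N \<psi>" "x \<in> space N"
  shows "\<psi> x = (\<Sum>y\<in>\<psi> ` space N. y * indicator (\<psi> -` {y} \<inter> space N) x)"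
proof -
  have "(\<Sum>y\<in>\<psi> ` space N. y * indicator (\<psi> -` {y} \<inter> space N) x) = (\<Sum>y\<in>\<psi> ` space N. if y = \<psi> x then y else 0)"
    using assms(2) by (intro sum.cong) (auto simp: indicator_def)
  then show ?thesis using assms by (simp add: simple_function_def)
qed

context
  fixes M :: "'a measure" and \<mu> :: "real measure" and W :: "real set \<Rightarrow> 'a \<Rightarrow> complex"
  assumes W: "orthogonal_random_measure M \<mu> W" and finite: "finite_measure \<mu>"
begin

lemma square_integrable_random_measure: "A \<in> sets \<mu> \<Longrightarrow> square_integrable M (W A)"
  using W by (simp add: orthogonal_random_measure_def)

text \<open>Split \<open>A\<close> and \<open>A'\<close> along their intersection: by orthogonality only the common part contributes.\<close>

lemma ip_random_measure:
  assumes A: "A \<in> sets \<mu>" and A': "A' \<in> sets \<mu>"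
  shows "ip M (W A) (W A') = of_real (measure \<mu> (A \<inter> A'))"
proof -
  have add: "AE \<omega> in M. W (S \<union> S') \<omega> = W S \<omega> + W S' \<omega>" and orth: "ip M (W S) (W S') = 0"
    if "S \<in> sets \<mu>" "S' \<in> sets \<mu>" "S \<inter> S' = {}" for S S'
    using W that unfolding orthogonal_random_measure_def ip_def by blast+
  let ?C = "A \<inter> A'" and ?D = "A - A'" and ?D' = "A' - A"
  note [simp] = sets.Int[OF A A'] sets.Diff[OF A A'] sets.Diff[OF A' A]
  note sq = square_integrable_random_measure
  have eq: "?C \<union> ?D = A" "?C \<union> ?D' = A'" by auto
  have "AE \<omega> in M. W A \<omega> = W ?C \<omega> + W ?D \<omega>" "AE \<omega> in M. W A' \<omega> = W ?C \<omega> + W ?D' \<omega>"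
    using add[of ?C ?D] add[of ?C ?D'] by (auto simp: eq)
  then have "ip M (W A) (W A') = ip M (\<lambda>\<omega>. W ?C \<omega> + W ?D \<omega>) (\<lambda>\<omega>. W ?C \<omega> + W ?D' \<omega>)"
    using A A' by (intro ip_cong_AE square_integrable_measurable sq square_integrable_add) auto
  also have "\<dots> = ip M (W ?C) (W ?C) + ip M (W ?C) (W ?D') + (ip M (W ?D) (W ?C) + ip M (W ?D) (W ?D'))"
    by (simp add: ip_add_left ip_add_right sq square_integrable_add)
  also have "\<dots> = ip M (W ?C) (W ?C)"
  proof -
    have "ip M (W ?C) (W ?D') = 0" "ip M (W ?D) (W ?C) = 0" "ip M (W ?D) (W ?D') = 0"
      by (intro orth; auto)+
    then show ?thesis by simp
  qed
  also have "\<dots> = of_real (measure \<mu> ?C)"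
    using W by (simp add: ip_self orthogonal_random_measure_def)
  finally show ?thesis .
qed

lemma square_integrable_simple_function:
  assumes "simple_function \<mu> \<psi>"
  shows "square_integrable \<mu> \<psi>"
proof (rule square_integrable_bound)
  interpret finite_measure \<mu> by (rule finite)
  show "integrable \<mu> (\<lambda>_. \<Sum>y\<in>\<psi> ` space \<mu>. (cmod y)\<^sup>2)" by simp
  show "AE x in \<mu>. (cmod (\<psi> x))\<^sup>2 \<le> (\<Sum>y\<in>\<psi> ` space \<mu>. (cmod y)\<^sup>2)"
    using assms by (intro AE_I2 member_le_sum) (auto simp: simple_function_def)
qed (rule borel_measurable_simple_function[OF assms])

lemma level_set_measurable: "simple_function \<mu> \<psi> \<Longrightarrow> \<psi> -` {y} \<inter> space \<mu> \<in> sets \<mu>"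
  by (rule simple_functionD)

lemma square_integrable_simple_stoch_integral:
  assumes "simple_function \<mu> \<psi>"
  shows "square_integrable M (simple_stoch_integral \<mu> W \<psi>)"
  unfolding simple_stoch_integral_def[abs_def]
  by (intro square_integrable_lincomb square_integrable_random_measure level_set_measurable assms)

lemma ip_simple_stoch_integral:
  assumes \<psi>: "simple_function \<mu> \<psi>" and \<psi>': "simple_function \<mu> \<psi>'"
  shows "ip M (simple_stoch_integral \<mu> W \<psi>) (simple_stoch_integral \<mu> W \<psi>') = ip \<mu> \<psi> \<psi>'"
proof -
  interpret finite_measure \<mu> by (rule finite)
  let ?L = "\<lambda>\<psi> y. \<psi> -` {y} \<inter> space \<mu>"
  have ind: "square_integrable \<mu> (\<lambda>x. indicator (?L \<psi> y) x)" if "simple_function \<mu> \<psi>" for \<psi> :: "real \<Rightarrow> complex" and y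
    by (intro square_integrable_simple_function simple_function_indicator level_set_measurable that)
  have ip_ind: "ip \<mu> (indicator (?L \<psi> y)) (indicator (?L \<psi>' y')) = of_real (measure \<mu> (?L \<psi> y \<inter> ?L \<psi>' y'))" for y y'
  proof -
    have "ip \<mu> (indicator (?L \<psi> y)) (indicator (?L \<psi>' y'))
        = (\<integral>x. of_real (indicator (?L \<psi> y \<inter> ?L \<psi>' y') x) \<partial>\<mu>)"
      unfolding ip_def by (intro Bochner_Integration.integral_cong) (auto simp: indicator_def)
    also have "\<dots> = of_real (measure \<mu> (?L \<psi> y \<inter> ?L \<psi>' y'))"
      using level_set_measurable[OF \<psi>] level_set_measurable[OF \<psi>']
      by (simp only: integral_complex_of_real) simp
    finally show ?thesis .
  qed
  have "ip \<mu> \<psi> \<psi>' = ip \<mu> (\<lambda>x. \<Sum>y\<in>\<psi> ` space \<mu>. y * indicator (?L \<psi> y) x)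
      (\<lambda>x. \<Sum>y\<in>\<psi>' ` space \<mu>. y * indicator (?L \<psi>' y) x)"
    unfolding ip_def
    by (intro Bochner_Integration.integral_cong refl arg_cong2[of _ _ _ _ "(*)"] arg_cong[of _ _ cnj]
          simple_function_lincomb \<psi> \<psi>')
  also have "\<dots> = (\<Sum>y\<in>\<psi> ` space \<mu>. \<Sum>y'\<in>\<psi>' ` space \<mu>. y * cnj y' * of_real (measure \<mu> (?L \<psi> y \<inter> ?L \<psi>' y')))"
    using ind[OF \<psi>] ind[OF \<psi>'] by (subst ip_lincomb) (simp_all add: ip_ind)
  also have "\<dots> = ip M (simple_stoch_integral \<mu> W \<psi>) (simple_stoch_integral \<mu> W \<psi>')"
    unfolding simple_stoch_integral_def[abs_def]
    using level_set_measurable[OF \<psi>] level_set_measurable[OF \<psi>']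
    by (subst ip_lincomb) (simp_all add: ip_random_measure square_integrable_random_measure)
  finally show ?thesis by simp
qed

lemma ip_stoch_integral:
  assumes "has_stoch_integral M \<mu> W \<phi> \<xi>" "has_stoch_integral M \<mu> W \<phi>' \<xi>'"
  shows "ip M \<xi> \<xi>' = ip \<mu> \<phi> \<phi>'"
proof -
  let ?I = "simple_stoch_integral \<mu> W"
  obtain \<psi> where \<psi>: "\<And>n. simple_function \<mu> (\<psi> n)" "(\<lambda>n. L2_dist_sq \<mu> (\<psi> n) \<phi>) \<longlonglongrightarrow> 0"
      "(\<lambda>n. L2_dist_sq M (?I (\<psi> n)) \<xi>) \<longlonglongrightarrow> 0"
    using assms(1) unfolding has_stoch_integral_def by blast
  obtain \<psi>' where \<psi>': "\<And>n. simple_function \<mu> (\<psi>' n)" "(\<lambda>n. L2_dist_sq \<mu> (\<psi>' n) \<phi>') \<longlonglongrightarrow> 0"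
      "(\<lambda>n. L2_dist_sq M (?I (\<psi>' n)) \<xi>') \<longlonglongrightarrow> 0"
    using assms(2) unfolding has_stoch_integral_def by blast
  have sq: "square_integrable \<mu> \<phi>" "square_integrable \<mu> \<phi>'" "square_integrable M \<xi>" "square_integrable M \<xi>'"
    using assms unfolding has_stoch_integral_def by auto
  have "(\<lambda>n. ip \<mu> (\<psi> n) (\<psi>' n)) \<longlonglongrightarrow> ip \<mu> \<phi> \<phi>'"
    by (rule ip_tendsto) (use \<psi> \<psi>' sq square_integrable_simple_function in auto)
  moreover have "(\<lambda>n. ip M (?I (\<psi> n)) (?I (\<psi>' n))) \<longlonglongrightarrow> ip M \<xi> \<xi>'"
    by (rule ip_tendsto) (use \<psi> \<psi>' sq square_integrable_simple_stoch_integral in auto)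
  ultimately show ?thesis
    using LIMSEQ_unique by (simp add: ip_simple_stoch_integral \<psi>(1) \<psi>'(1)) blast
qed

lemma stoch_integral_isometry:
  assumes "has_stoch_integral M \<mu> W \<phi> \<xi>" "has_stoch_integral M \<mu> W \<phi>' \<xi>'"
  shows "L2_dist_sq M \<xi> \<xi>' = L2_dist_sq \<mu> \<phi> \<phi>'"
  using assms ip_stoch_integral[OF assms(1,1)] ip_stoch_integral[OF assms(2,2)]
    ip_stoch_integral[OF assms(1,2)] ip_stoch_integral[OF assms(2,1)]
  by (simp add: L2_dist_sq_ip has_stoch_integral_def)

lemma stoch_integral_norm:
  assumes "has_stoch_integral M \<mu> W \<phi> \<xi>"
  shows "(\<integral>\<omega>. (cmod (\<xi> \<omega>))\<^sup>2 \<partial>M) = (\<integral>u. (cmod (\<phi> u))\<^sup>2 \<partial>\<mu>)"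
  using ip_stoch_integral[OF assms assms] unfolding ip_self by (simp only: of_real_eq_iff)

lemma has_stoch_integral_cong_AE:
  assumes "has_stoch_integral M \<mu> W \<phi> \<xi>" "square_integrable M \<xi>'" "AE \<omega> in M. \<xi> \<omega> = \<xi>' \<omega>"
  shows "has_stoch_integral M \<mu> W \<phi> \<xi>'"
proof -
  have "L2_dist_sq M X \<xi> = L2_dist_sq M X \<xi>'" if "square_integrable M X" for X
    unfolding L2_dist_sq_def
  proof (rule integral_cong_AE)
    show "AE \<omega> in M. (cmod (X \<omega> - \<xi> \<omega>))\<^sup>2 = (cmod (X \<omega> - \<xi>' \<omega>))\<^sup>2"
      using assms(3) by eventually_elim simp
  qed (use assms that in \<open>auto simp: has_stoch_integral_def square_integrable_def\<close>)
  then show ?thesis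
    using assms(1,2) square_integrable_simple_stoch_integral
    unfolding has_stoch_integral_def by auto
qed

text \<open>Simple functions are dense in \<open>L\<^sub>2(\<mu>)\<close>, the elementary integral is isometric, and \<open>L\<^sub>2(M)\<close> is
  complete.\<close>

lemma has_stoch_integral_exists:
  assumes \<phi>: "square_integrable \<mu> \<phi>"
  obtains \<xi> where "has_stoch_integral M \<mu> W \<phi> \<xi>"
proof -
  have \<phi>m: "\<phi> \<in> borel_measurable \<mu>" using \<phi> by (simp add: square_integrable_def)
  obtain \<psi> where \<psi>: "\<And>n. simple_function \<mu> (\<psi> n)" "\<And>x. x \<in> space \<mu> \<Longrightarrow> (\<lambda>n. \<psi> n x) \<longlonglongrightarrow> \<phi> x"
      "\<And>n x. x \<in> space \<mu> \<Longrightarrow> dist (\<psi> n x) 0 \<le> 2 * dist (\<phi> x) 0"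
    using borel_measurable_implies_sequence_metric[OF \<phi>m, of 0] by blast
  note s\<psi> = square_integrable_simple_function[OF \<psi>(1)]
  have "(\<lambda>n. L2_dist_sq \<mu> (\<psi> n) \<phi>) \<longlonglongrightarrow> (\<integral>x. 0 \<partial>\<mu>)"
    unfolding L2_dist_sq_def
  proof (rule integral_dominated_convergence)
    show "integrable \<mu> (\<lambda>x. 9 * (cmod (\<phi> x))\<^sup>2)" using \<phi> by (simp add: square_integrable_def)
    show "(\<lambda>x. (cmod (\<psi> n x - \<phi> x))\<^sup>2) \<in> borel_measurable \<mu>" for n
      using square_integrable_diff[OF s\<psi>[of n] \<phi>]
      by (auto simp: square_integrable_def intro: borel_measurable_integrable)
    show "AE x in \<mu>. (\<lambda>n. (cmod (\<psi> n x - \<phi> x))\<^sup>2) \<longlonglongrightarrow> 0"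
    proof (intro AE_I2)
      fix x assume "x \<in> space \<mu>"
      then have "(\<lambda>n. (cmod (\<psi> n x - \<phi> x))\<^sup>2) \<longlonglongrightarrow> (cmod (\<phi> x - \<phi> x))\<^sup>2"
        by (intro tendsto_intros \<psi>(2))
      then show "(\<lambda>n. (cmod (\<psi> n x - \<phi> x))\<^sup>2) \<longlonglongrightarrow> 0" by simp
    qed
    show "AE x in \<mu>. norm ((cmod (\<psi> n x - \<phi> x))\<^sup>2) \<le> 9 * (cmod (\<phi> x))\<^sup>2" for n
    proof (intro AE_I2)
      fix x assume x: "x \<in> space \<mu>"
      have "cmod (\<psi> n x - \<phi> x) \<le> cmod (\<psi> n x) + cmod (\<phi> x)" by (rule norm_triangle_ineq4)
      also have "\<dots> \<le> 3 * cmod (\<phi> x)" using \<psi>(3)[OF x, of n] by simp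
      finally have "(cmod (\<psi> n x - \<phi> x))\<^sup>2 \<le> (3 * cmod (\<phi> x))\<^sup>2" by (intro power_mono) auto
      then show "norm ((cmod (\<psi> n x - \<phi> x))\<^sup>2) \<le> 9 * (cmod (\<phi> x))\<^sup>2" by (simp add: power_mult_distrib)
    qed
  qed simp
  then have lim: "(\<lambda>n. L2_dist_sq \<mu> (\<psi> n) \<phi>) \<longlonglongrightarrow> 0" by simp
  let ?I = "\<lambda>n. simple_stoch_integral \<mu> W (\<psi> n)"
  note sI = square_integrable_simple_stoch_integral[OF \<psi>(1)]
  have iso: "L2_dist_sq M (?I m) (?I n) = L2_dist_sq \<mu> (\<psi> m) (\<psi> n)" for m n
    by (simp add: L2_dist_sq_ip s\<psi> sI ip_simple_stoch_integral \<psi>(1))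
  have "\<exists>K. \<forall>m\<ge>K. \<forall>n\<ge>K. L2_dist_sq M (?I m) (?I n) < e" if "e > 0" for e
  proof -
    obtain K where K: "\<And>n. n \<ge> K \<Longrightarrow> L2_dist_sq \<mu> (\<psi> n) \<phi> < e / 4"
      using order_tendstoD(2)[OF lim, of "e / 4"] \<open>e > 0\<close> by (auto simp: eventually_sequentially)
    have "L2_dist_sq M (?I m) (?I n) < e" if "m \<ge> K" "n \<ge> K" for m n
      using L2_dist_sq_triangle[OF s\<psi>[of m] \<phi> s\<psi>[of n]] K[OF that(1)] K[OF that(2)]
      by (simp add: iso L2_dist_sq_commute[of \<mu> \<phi>])
    then show ?thesis by blast
  qed
  then obtain \<xi> where "square_integrable M \<xi>" "(\<lambda>n. L2_dist_sq M (?I n) \<xi>) \<longlonglongrightarrow> 0"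
    using L2_complete[of M ?I] sI by blast
  then show thesis
    using that[of \<xi>] \<phi> lim \<psi>(1) unfolding has_stoch_integral_def by blast
qed

lemma has_stoch_integral_stoch_integral:
  assumes "square_integrable \<mu> \<phi>"
  shows "has_stoch_integral M \<mu> W \<phi> (stoch_integral M \<mu> W \<phi>)"
  using has_stoch_integral_exists[OF assms] unfolding stoch_integral_def by (metis someI)

lemma closed_span_stoch_integral_iff:
  assumes \<xi>: "has_stoch_integral M \<mu> W \<phi> \<xi>" and B: "\<And>s. has_stoch_integral M \<mu> W (e s) (B s)"
  shows "\<xi> \<in> closed_span M B T \<longleftrightarrow> \<phi> \<in> closed_span \<mu> e T"
proof -
  have "L2_dist_sq M \<xi> (\<lambda>\<omega>. \<Sum>s\<in>F. c s * B s \<omega>) = L2_dist_sq \<mu> \<phi> (\<lambda>u. \<Sum>s\<in>F. c s * e s u)" for F c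
    by (rule L2_dist_sq_lincomb_isometric)
       (use \<xi> B ip_stoch_integral in \<open>auto simp: has_stoch_integral_def\<close>)
  moreover have "square_integrable M \<xi>" "square_integrable \<mu> \<phi>" using \<xi> by (auto simp: has_stoch_integral_def)
  ultimately show ?thesis unfolding closed_span_def by simp
qed

lemma has_stoch_integral_unique:
  assumes "has_stoch_integral M \<mu> W \<phi> \<xi>" "has_stoch_integral M \<mu> W \<phi>' \<xi>"
  shows "AE u in \<mu>. \<phi> u = \<phi>' u"
proof -
  have "L2_dist_sq \<mu> \<phi> \<phi>' = 0"
    using stoch_integral_isometry[OF assms] by (simp add: L2_dist_sq_def)
  then show ?thesis using assms L2_dist_sq_eq_0_iff by (auto simp: has_stoch_integral_def)
qed

text \<open>Approximating combinations of the \<open>B s\<close> are integrals of the same combinations of the \<open>e s\<close>. By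
  the isometry the latter form a Cauchy sequence, and the integral of their limit is \<open>Y\<close>.\<close>

lemma closed_span_has_stoch_integral:
  assumes Y: "Y \<in> closed_span M B T" and B: "\<And>s. has_stoch_integral M \<mu> W (e s) (B s)"
  obtains \<phi> where "has_stoch_integral M \<mu> W \<phi> Y"
proof -
  have sB: "square_integrable M (B s)" and se: "square_integrable \<mu> (e s)" for s
    using B[of s] by (auto simp: has_stoch_integral_def)
  have sY: "square_integrable M Y"
    and approx: "\<And>\<epsilon>. \<epsilon> > 0 \<Longrightarrow> \<exists>F c. L2_dist_sq M Y (\<lambda>\<omega>. \<Sum>s\<in>F. c s * B s \<omega>) < \<epsilon>"
    using Y unfolding closed_span_def by blast+
  have "\<exists>F c. L2_dist_sq M Y (\<lambda>\<omega>. \<Sum>s\<in>F. c s * B s \<omega>) < 1 / Suc n" for n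
    by (rule approx) simp
  then obtain F c where Fc: "\<And>n. L2_dist_sq M Y (\<lambda>\<omega>. \<Sum>s\<in>F n. c n s * B s \<omega>) < 1 / Suc n" by metis
  define P where "P n \<omega> = (\<Sum>s\<in>F n. c n s * B s \<omega>)" for n \<omega>
  define p where "p n u = (\<Sum>s\<in>F n. c n s * e s u)" for n u
  have sP: "square_integrable M (P n)" and sp: "square_integrable \<mu> (p n)" for n
    unfolding P_def p_def by (intro square_integrable_lincomb sB se)+
  have iso: "L2_dist_sq M \<xi> (P n) = L2_dist_sq \<mu> \<phi> (p n)" if "has_stoch_integral M \<mu> W \<phi> \<xi>" for \<xi> \<phi> n
    unfolding P_def p_def
    by (rule L2_dist_sq_lincomb_isometric)
       (use that B ip_stoch_integral in \<open>auto simp: has_stoch_integral_def\<close>)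
  have pP: "has_stoch_integral M \<mu> W (p n) (P n)" for n
  proof -
    obtain \<xi> where \<xi>: "has_stoch_integral M \<mu> W (p n) \<xi>" using has_stoch_integral_exists[OF sp] .
    then have "L2_dist_sq M \<xi> (P n) = 0" by (simp add: iso) (simp add: L2_dist_sq_def)
    then show ?thesis
      using \<xi> sP[of n] L2_dist_sq_eq_0_iff by (intro has_stoch_integral_cong_AE[OF \<xi>]) (auto simp: has_stoch_integral_def)
  qed
  have limY: "(\<lambda>n. L2_dist_sq M Y (P n)) \<longlonglongrightarrow> 0"
  proof (rule tendsto_sandwich[OF _ _ tendsto_const])
    show "\<forall>\<^sub>F n in sequentially. L2_dist_sq M Y (P n) \<le> 1 / real (Suc n)"
      using Fc by (auto simp: P_def[abs_def] less_imp_le)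
    show "(\<lambda>n. 1 / real (Suc n)) \<longlonglongrightarrow> 0" using LIMSEQ_Suc[OF lim_1_over_n[where 'a = real]] .
  qed simp
  have "\<exists>K. \<forall>m\<ge>K. \<forall>n\<ge>K. L2_dist_sq \<mu> (p m) (p n) < \<epsilon>" if "\<epsilon> > 0" for \<epsilon>
  proof -
    obtain K where K: "\<And>n. n \<ge> K \<Longrightarrow> L2_dist_sq M Y (P n) < \<epsilon> / 4"
      using order_tendstoD(2)[OF limY, of "\<epsilon> / 4"] \<open>\<epsilon> > 0\<close> by (auto simp: eventually_sequentially)
    have "L2_dist_sq \<mu> (p m) (p n) < \<epsilon>" if "m \<ge> K" "n \<ge> K" for m n
      using L2_dist_sq_triangle[OF sP[of m] sY sP[of n]] K[OF that(1)] K[OF that(2)]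
      by (simp add: stoch_integral_isometry[OF pP pP, symmetric] L2_dist_sq_commute[of M _ Y])
    then show ?thesis by blast
  qed
  then obtain \<phi> where \<phi>: "square_integrable \<mu> \<phi>" "(\<lambda>n. L2_dist_sq \<mu> (p n) \<phi>) \<longlonglongrightarrow> 0"
    using L2_complete[of \<mu> p] sp by blast
  obtain \<xi> where \<xi>: "has_stoch_integral M \<mu> W \<phi> \<xi>" using has_stoch_integral_exists[OF \<phi>(1)] .
  then have s\<xi>: "square_integrable M \<xi>" by (simp add: has_stoch_integral_def)
  have "(\<lambda>n. L2_dist_sq M (P n) \<xi>) \<longlonglongrightarrow> 0"
    using \<phi>(2) by (simp add: stoch_integral_isometry[OF pP \<xi>])
  then have "(\<lambda>n. L2_dist_sq M (P n) Y) \<longlonglongrightarrow> L2_dist_sq M \<xi> Y"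
    by (intro L2_dist_sq_tendsto sP s\<xi> sY)
  then have "L2_dist_sq M \<xi> Y = 0"
    using limY LIMSEQ_unique by (simp add: L2_dist_sq_commute[of M _ Y]) blast
  then show thesis
    using that \<xi> sY s\<xi> by (auto intro: has_stoch_integral_cong_AE simp: L2_dist_sq_eq_0_iff)
qed

text \<open>The isometry turns the interpolation problem into one in \<open>L\<^sub>2(\<mu>)\<close>, where the filter is
  multiplication by \<open>l\<close>. It suffices to know a minimiser there: its stochastic integral is a minimiser
  among the random variables, whichever representative \<open>integrand\<close> selects, as these agree
  almost everywhere.\<close>

lemma sigma_int_sq_eqI:
  assumes B: "\<And>s. has_stoch_integral M \<mu> W (e s) (B s)" and l: "l \<in> borel_measurable \<mu>"
    and \<phi>: "\<phi> \<in> closed_span \<mu> e {s. \<bar>s\<bar> \<ge> 1}" "square_integrable \<mu> (\<lambda>u. l u * \<phi> u)"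
      "L2_dist_sq \<mu> \<phi> (e 0) + (\<integral>u. (cmod (l u * \<phi> u))\<^sup>2 \<partial>\<mu>) = v"
    and le: "\<And>\<eta>. \<eta> \<in> closed_span \<mu> e {s. \<bar>s\<bar> \<ge> 1} \<Longrightarrow> square_integrable \<mu> (\<lambda>u. l u * \<eta> u) \<Longrightarrow>
      v \<le> L2_dist_sq \<mu> \<eta> (e 0) + (\<integral>u. (cmod (l u * \<eta> u))\<^sup>2 \<partial>\<mu>)"
  shows "sigma_int_sq M B \<mu> W l = v"
proof -
  let ?T = "{s::int. \<bar>s\<bar> \<ge> 1}"
  let ?J = "\<lambda>\<eta>. L2_dist_sq \<mu> \<eta> (e 0) + (\<integral>u. (cmod (l u * \<eta> u))\<^sup>2 \<partial>\<mu>)"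
  let ?S = "closed_span M B ?T \<inter> filter_domain M B \<mu> W l"
  let ?G = "\<lambda>Y. (\<integral>\<omega>. (cmod (Y \<omega> - B 0 \<omega>))\<^sup>2 \<partial>M) + (\<integral>\<omega>. (cmod (linear_filter M \<mu> W l Y \<omega>))\<^sup>2 \<partial>M)"
  have integrand: "has_stoch_integral M \<mu> W (integrand M \<mu> W Y) Y" if "has_stoch_integral M \<mu> W \<eta> Y" for \<eta> Y
    unfolding integrand_def using that by (rule someI[of "\<lambda>\<phi>. has_stoch_integral M \<mu> W \<phi> Y"])
  have G: "?G Y = ?J (integrand M \<mu> W Y)"
    if "has_stoch_integral M \<mu> W (integrand M \<mu> W Y) Y" "square_integrable \<mu> (\<lambda>u. l u * integrand M \<mu> W Y u)" for Y
    using stoch_integral_isometry[OF that(1) B, of 0]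
      stoch_integral_norm[OF has_stoch_integral_stoch_integral[OF that(2)]]
    by (simp add: L2_dist_sq_def linear_filter_def)
  have lower: "v \<le> ?G Y" if "Y \<in> ?S" for Y
  proof -
    have "Y \<in> closed_span M B ?T" using that by simp
    then obtain \<eta> where "has_stoch_integral M \<mu> W \<eta> Y"
      using B by (rule closed_span_has_stoch_integral)
    note h = integrand[OF this]
    have sq: "square_integrable \<mu> (\<lambda>u. l u * integrand M \<mu> W Y u)"
      using that by (simp add: filter_domain_def)
    have "integrand M \<mu> W Y \<in> closed_span \<mu> e ?T"
      using that closed_span_stoch_integral_iff[OF h B] by simp
    then show ?thesis using le sq G[OF h sq] by simp
  qed
  have s\<phi>: "square_integrable \<mu> \<phi>" using \<phi>(1) by (simp add: closed_span_def)
  obtain Y where Y: "has_stoch_integral M \<mu> W \<phi> Y" using has_stoch_integral_exists[OF s\<phi>] .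
  note h = integrand[OF Y]
  let ?\<eta> = "integrand M \<mu> W Y"
  have s\<eta>: "square_integrable \<mu> ?\<eta>" using h by (simp add: has_stoch_integral_def)
  have AE: "AE u in \<mu>. ?\<eta> u = \<phi> u" using has_stoch_integral_unique[OF h Y] .
  have sq: "square_integrable \<mu> (\<lambda>u. l u * ?\<eta> u)"
  proof (rule square_integrable_bound)
    show "integrable \<mu> (\<lambda>u. (cmod (l u * \<phi> u))\<^sup>2)" using \<phi>(2) by (simp add: square_integrable_def)
    show "AE u in \<mu>. (cmod (l u * ?\<eta> u))\<^sup>2 \<le> (cmod (l u * \<phi> u))\<^sup>2"
      using AE by eventually_elim simp
  qed (use l s\<eta> in \<open>auto simp: square_integrable_def\<close>)
  have YT: "Y \<in> closed_span M B ?T"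
    using \<phi>(1) closed_span_stoch_integral_iff[OF Y B] by simp
  moreover have "Y \<in> closed_span M B UNIV"
    using YT unfolding closed_span_def by blast
  ultimately have YS: "Y \<in> ?S" using sq by (simp add: filter_domain_def)
  have "L2_dist_sq \<mu> ?\<eta> (e 0) = L2_dist_sq \<mu> \<phi> (e 0)"
    using stoch_integral_isometry[OF h B, of 0] stoch_integral_isometry[OF Y B, of 0] by simp
  moreover have "(\<integral>u. (cmod (l u * ?\<eta> u))\<^sup>2 \<partial>\<mu>) = (\<integral>u. (cmod (l u * \<phi> u))\<^sup>2 \<partial>\<mu>)"
  proof (rule integral_cong_AE)
    show "AE u in \<mu>. (cmod (l u * ?\<eta> u))\<^sup>2 = (cmod (l u * \<phi> u))\<^sup>2"
      using AE by eventually_elim simp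
  qed (use sq \<phi>(2) in \<open>auto simp: square_integrable_def\<close>)
  ultimately have "?G Y = v" using G[OF h sq] \<phi>(3) by simp
  then show ?thesis
    unfolding sigma_int_sq_def using YS lower by (intro cInf_eq_minimum) auto
qed

end

section \<open>The extremal problem for the spectral density\<close>

abbreviation character :: "int \<Rightarrow> real \<Rightarrow> complex" where
  "character s u \<equiv> cis (of_int s * u)"

text \<open>The weight with which the norm of the predictor enters the total error, one unit coming from the
  interpolation error and \<open>\<bar>l\<bar>\<^sup>2\<close> from the filter.\<close>

definition amp :: "(real \<Rightarrow> complex) \<Rightarrow> real \<Rightarrow> real" where
  "amp l u = 1 + (cmod (l u))\<^sup>2"

definition inverse_amp_integral :: "(real \<Rightarrow> complex) \<Rightarrow> real" where
  "inverse_amp_integral l = (\<integral>u. 1 / amp l u \<partial>leb_circle)"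

definition reciprocal_integral :: "(real \<Rightarrow> real) \<Rightarrow> (real \<Rightarrow> complex) \<Rightarrow> real" where
  "reciprocal_integral f l = (\<integral>u. 1 / (f u * amp l u) \<partial>leb_circle)"

lemma amp_ge_1: "1 \<le> amp l u" by (simp add: amp_def)

text \<open>Without a constraint the integrand of the total error is minimised pointwise at \<open>1 / amp l\<close>, and
  what remains is the residue that no predictor can avoid.\<close>

lemma complete_the_square:
  "(cmod (z - 1))\<^sup>2 + (cmod (l u * z))\<^sup>2 = amp l u * (cmod (z - of_real (1 / amp l u)))\<^sup>2 + (cmod (l u))\<^sup>2 / amp l u"
proof -
  have a: "amp l u > 0" using amp_ge_1[of l u] by linarith
  have l: "(cmod (l u))\<^sup>2 = amp l u - 1" by (simp add: amp_def)
  have z: "(cmod (z - of_real t))\<^sup>2 = (cmod z)\<^sup>2 - 2 * t * Re z + t\<^sup>2" for t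
    by (simp add: cmod_power2) (simp add: power2_eq_square algebra_simps)
  have z1: "(cmod (z - 1))\<^sup>2 = (cmod z)\<^sup>2 - 2 * Re z + 1" using z[of 1] by simp
  show ?thesis
    unfolding z z1 norm_mult power_mult_distrib l using a by (simp add: field_simps power2_eq_square)
qed

lemma reciprocal_ennreal: "0 < x \<Longrightarrow> 1 / ennreal x = ennreal (1 / x)"
  using divide_ennreal[of 1 x] by simp

context
  fixes f :: "real \<Rightarrow> real" and l :: "real \<Rightarrow> complex"
  assumes f_integrable: "integrable leb_circle f" and f_nonneg: "\<And>u. u \<in> {-pi..<pi} \<Longrightarrow> 0 \<le> f u"
    and l_measurable [measurable]: "l \<in> borel_measurable leb_circle"
begin

private abbreviation (input) \<mu> where "\<mu> \<equiv> density_measure f"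
private abbreviation (input) N where "N \<equiv> leb_circle"

lemma f_measurable [measurable]: "f \<in> borel_measurable N"
  using f_integrable by simp

lemma AE_f_nonneg: "AE u in N. 0 \<le> f u"
  using f_nonneg by (intro AE_I2) (simp add: space_restrict_space)

lemma amp_measurable [measurable]: "amp l \<in> borel_measurable N"
  unfolding amp_def[abs_def] by measurable

lemma integral_spectral:
  fixes h :: "real \<Rightarrow> 'b::{banach, second_countable_topology}"
  assumes "h \<in> borel_measurable N"
  shows "(\<integral>u. h u \<partial>\<mu>) = (\<integral>u. f u *\<^sub>R h u \<partial>N)"
  using assms AE_f_nonneg by (intro integral_density) auto

lemma integrable_spectral:
  fixes h :: "real \<Rightarrow> 'b::{banach, second_countable_topology}"
  assumes "h \<in> borel_measurable N"
  shows "integrable \<mu> h \<longleftrightarrow> integrable N (\<lambda>u. f u *\<^sub>R h u)"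
  using assms AE_f_nonneg by (intro integrable_density) auto

lemma finite_spectral: "finite_measure \<mu>"
proof (rule finite_measureI)
  have "emeasure \<mu> (space N) = (\<integral>\<^sup>+u. ennreal (f u) * indicator (space N) u \<partial>N)"
    by (rule emeasure_density) (use sets.top[of N] in auto)
  also have "\<dots> = (\<integral>\<^sup>+u. ennreal (f u) \<partial>N)"
    by (intro nn_integral_cong) simp
  also have "\<dots> < \<infinity>"
    using nn_integral_eq_integral[OF f_integrable AE_f_nonneg] by simp
  finally show "emeasure \<mu> (space \<mu>) \<noteq> \<infinity>" by (simp add: space_density)
qed

lemma square_integrable_spectral_iff:
  assumes [measurable]: "X \<in> borel_measurable N"
  shows "square_integrable \<mu> X \<longleftrightarrow> integrable N (\<lambda>u. f u * (cmod (X u))\<^sup>2)"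
  unfolding square_integrable_def by (subst integrable_spectral) auto

lemma square_integrable_measurable_spectral:
  "square_integrable \<mu> X \<Longrightarrow> X \<in> borel_measurable N"
  by (simp add: square_integrable_def)

lemma character_measurable [measurable]: "character s \<in> borel_measurable N"
  by (intro measurable_restrict_space1) (simp, intro borel_measurable_continuous_onI continuous_intros)

lemma square_integrable_bounded_spectral:
  assumes [measurable]: "X \<in> borel_measurable N" and b: "\<And>u. cmod (X u) \<le> 1"
  shows "square_integrable \<mu> X"
proof (rule square_integrable_bound)
  interpret finite_measure \<mu> by (rule finite_spectral)
  show "integrable \<mu> (\<lambda>_. 1 :: real)" by simp
  show "AE u in \<mu>. (cmod (X u))\<^sup>2 \<le> 1" using b by (intro AE_I2) (simp add: power_le_one)
qed simp

lemma square_integrable_character: "square_integrable \<mu> (character s)"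
  by (rule square_integrable_bounded_spectral) simp_all

text \<open>The inner products with the characters are the Fourier coefficients of \<open>f r\<close>, so only the one at
  frequency zero can survive.\<close>

lemma orthogonal_to_nonzero_characters:
  assumes r: "square_integrable \<mu> r" and orth: "\<And>s. \<bar>s\<bar> \<ge> 1 \<Longrightarrow> ip \<mu> r (character s) = 0"
  obtains c where "AE u in N. of_real (f u) * r u = c"
proof -
  have [measurable]: "r \<in> borel_measurable N" using r by (rule square_integrable_measurable_spectral)
  have int: "integrable N (\<lambda>u. of_real (f u) * r u)"
  proof -
    have "integrable \<mu> (\<lambda>u. r u * cnj (character 0 u))"
      by (rule integrable_mult_cnj[OF r square_integrable_character])
    then show ?thesis by (subst (asm) integrable_spectral) (auto simp: scaleR_conv_of_real)
  qed
  have "(\<integral>u. of_real (f u) * r u * cis (of_int s * u) \<partial>N) = 0" if "s \<noteq> 0" for s :: int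
  proof -
    have "ip \<mu> r (character (- s)) = (\<integral>u. f u *\<^sub>R (r u * cnj (character (- s) u)) \<partial>N)"
      unfolding ip_def by (rule integral_spectral) measurable
    also have "\<dots> = (\<integral>u. of_real (f u) * r u * cis (of_int s * u) \<partial>N)"
      by (simp add: scaleR_conv_of_real cis_cnj mult.assoc)
    finally show ?thesis using orth[of "- s"] that by simp
  qed
  from AE_constant_if_nonzero_Fourier_coefficients_zero[OF int this] that show thesis by blast
qed

text \<open>Pairing with such a vector sees nothing but the integral with respect to Lebesgue measure.\<close>

lemma ip_spectral_of_constant:
  assumes X: "square_integrable \<mu> X" and r: "square_integrable \<mu> r"
    and c: "AE u in N. of_real (f u) * r u = c"
  shows "ip \<mu> X r = cnj c * (\<integral>u. X u \<partial>N)"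
proof -
  note [measurable] = X[THEN square_integrable_measurable_spectral] r[THEN square_integrable_measurable_spectral]
  have "ip \<mu> X r = (\<integral>u. f u *\<^sub>R (X u * cnj (r u)) \<partial>N)"
    unfolding ip_def by (rule integral_spectral) measurable
  also have "\<dots> = (\<integral>u. cnj c * X u \<partial>N)"
  proof (rule integral_cong_AE)
    show "AE u in N. f u *\<^sub>R (X u * cnj (r u)) = cnj c * X u"
      using c by eventually_elim (auto simp: scaleR_conv_of_real)
  qed measurable
  finally show ?thesis by simp
qed

text \<open>An orthogonal vector equals \<open>c / f\<close>, and its squared norm is \<open>\<bar>c\<bar>\<^sup>2\<close> times the integral of \<open>1 / f\<close>, so that
  \<open>c = 0\<close>.\<close>

lemma closed_span_if_reciprocal_not_integrable:
  assumes inf: "(\<integral>\<^sup>+u. 1 / ennreal (f u) \<partial>N) = \<infinity>" and X: "square_integrable \<mu> X"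
  shows "X \<in> closed_span \<mu> character {s. \<bar>s\<bar> \<ge> 1}"
proof (rule closed_span_if_orthogonal[OF square_integrable_character X])
  fix r assume r: "square_integrable \<mu> r"
    and orth: "\<And>s. s \<in> {s. \<bar>s\<bar> \<ge> 1} \<Longrightarrow> ip \<mu> r (character s) = 0"
  obtain c where c: "AE u in N. of_real (f u) * r u = c"
    using orthogonal_to_nonzero_characters[OF r] orth by blast
  have "c = 0"
  proof (rule ccontr)
    assume "c \<noteq> 0"
    note [measurable] = r[THEN square_integrable_measurable_spectral]
    have int: "integrable N (\<lambda>u. f u * (cmod (r u))\<^sup>2 / (cmod c)\<^sup>2)"
      using r by (simp add: square_integrable_spectral_iff)
    have "(\<integral>\<^sup>+u. 1 / ennreal (f u) \<partial>N) = (\<integral>\<^sup>+u. ennreal (f u * (cmod (r u))\<^sup>2 / (cmod c)\<^sup>2) \<partial>N)"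
    proof (rule nn_integral_cong_AE, use c AE_f_nonneg in eventually_elim)
      case (elim u)
      then have fu: "f u > 0" using \<open>c \<noteq> 0\<close> by (auto simp: less_le)
      have "(cmod c)\<^sup>2 = (f u)\<^sup>2 * (cmod (r u))\<^sup>2"
        using fu by (simp add: elim(1)[symmetric] norm_mult power_mult_distrib)
      moreover have "r u \<noteq> 0" using elim(1) \<open>c \<noteq> 0\<close> by auto
      ultimately have "1 / f u = f u * (cmod (r u))\<^sup>2 / (cmod c)\<^sup>2"
        using fu by (simp add: field_simps power2_eq_square)
      then show ?case using reciprocal_ennreal[OF fu] by simp
    qed
    also have "\<dots> < \<infinity>"
    proof -
      have "AE u in N. 0 \<le> f u * (cmod (r u))\<^sup>2 / (cmod c)\<^sup>2"
        using AE_f_nonneg by eventually_elim simp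
      then show ?thesis by (subst nn_integral_eq_integral[OF int]) auto
    qed
    finally show False using inf by simp
  qed
  then show "ip \<mu> X r = 0" using ip_spectral_of_constant[OF X r c] by simp
qed

lemma amp_identity:
  assumes X: "square_integrable \<mu> X" and lX: "square_integrable \<mu> (\<lambda>u. l u * X u)"
  shows "integrable N (\<lambda>u. amp l u * f u * (cmod (X u - of_real (1 / amp l u)))\<^sup>2)" (is ?int)
    and "L2_dist_sq \<mu> X (character 0) + (\<integral>u. (cmod (l u * X u))\<^sup>2 \<partial>\<mu>)
      = (\<integral>u. amp l u * f u * (cmod (X u - of_real (1 / amp l u)))\<^sup>2 \<partial>N)
        + (\<integral>u. (cmod (l u))\<^sup>2 / (1 + (cmod (l u))\<^sup>2) * f u \<partial>N)" (is ?eq)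
proof -
  note [measurable] = X[THEN square_integrable_measurable_spectral]
  have d: "square_integrable \<mu> (\<lambda>u. X u - character 0 u)"
    by (rule square_integrable_diff[OF X square_integrable_character])
  have i1: "integrable N (\<lambda>u. f u * (cmod (X u - 1))\<^sup>2)"
    using d by (subst (asm) square_integrable_spectral_iff) auto
  have i2: "integrable N (\<lambda>u. f u * (cmod (l u * X u))\<^sup>2)"
    using lX by (subst (asm) square_integrable_spectral_iff) auto
  have i3: "integrable N (\<lambda>u. (cmod (l u))\<^sup>2 / amp l u * f u)"
  proof (rule Bochner_Integration.integrable_bound[OF f_integrable])
    show "AE u in N. norm ((cmod (l u))\<^sup>2 / amp l u * f u) \<le> norm (f u)"
    proof (intro AE_I2)
      fix u
      have q: "(cmod (l u))\<^sup>2 / amp l u \<le> 1" "0 \<le> (cmod (l u))\<^sup>2 / amp l u"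
        by (auto simp: amp_def divide_le_eq_1 intro!: add_pos_nonneg divide_nonneg_nonneg)
      then show "norm ((cmod (l u))\<^sup>2 / amp l u * f u) \<le> norm (f u)"
        using mult_right_mono[OF q(1), of "\<bar>f u\<bar>"]
        by (simp only: real_norm_def abs_mult abs_of_nonneg[OF q(2)] mult_1)
    qed
  qed measurable
  have pt: "amp l u * f u * (cmod (X u - of_real (1 / amp l u)))\<^sup>2
      = f u * (cmod (X u - 1))\<^sup>2 + f u * (cmod (l u * X u))\<^sup>2 - (cmod (l u))\<^sup>2 / amp l u * f u" for u
  proof -
    have "f u * ((cmod (X u - 1))\<^sup>2 + (cmod (l u * X u))\<^sup>2)
        = f u * (amp l u * (cmod (X u - of_real (1 / amp l u)))\<^sup>2 + (cmod (l u))\<^sup>2 / amp l u)"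
      by (simp only: complete_the_square)
    then show ?thesis by (simp only: distrib_left) (simp add: mult_ac)
  qed
  show ?int unfolding pt using i1 i2 i3 by simp
  have "L2_dist_sq \<mu> X (character 0) = (\<integral>u. f u * (cmod (X u - 1))\<^sup>2 \<partial>N)"
    unfolding L2_dist_sq_def by (subst integral_spectral) auto
  moreover have "(\<integral>u. (cmod (l u * X u))\<^sup>2 \<partial>\<mu>) = (\<integral>u. f u * (cmod (l u * X u))\<^sup>2 \<partial>N)"
    by (subst integral_spectral) auto
  moreover have "(\<integral>u. amp l u * f u * (cmod (X u - of_real (1 / amp l u)))\<^sup>2 \<partial>N)
     = (\<integral>u. f u * (cmod (X u - 1))\<^sup>2 \<partial>N) + (\<integral>u. f u * (cmod (l u * X u))\<^sup>2 \<partial>N) - (\<integral>u. (cmod (l u))\<^sup>2 / amp l u * f u \<partial>N)"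
    unfolding pt using i1 i2 i3 by simp
  ultimately show ?eq by (simp add: amp_def)
qed

text \<open>A process with non-integrable reciprocal density is interpolated without error, so the whole
  space is available and only the multiplier \<open>1 / amp l\<close> matters.\<close>

lemma optimal_of_reciprocal_not_integrable:
  assumes inf: "(\<integral>\<^sup>+u. 1 / ennreal (f u) \<partial>N) = \<infinity>"
  obtains X where "X \<in> closed_span \<mu> character {s. \<bar>s\<bar> \<ge> 1}" "square_integrable \<mu> (\<lambda>u. l u * X u)"
    "(\<integral>u. amp l u * f u * (cmod (X u - of_real (1 / amp l u)))\<^sup>2 \<partial>N) = 0"
proof
  let ?X = "\<lambda>u. complex_of_real (1 / amp l u)"
  have a: "amp l u > 0" for u using amp_ge_1[of l u] by linarith
  have "square_integrable \<mu> ?X"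
    by (rule square_integrable_bounded_spectral) (use amp_ge_1 a in \<open>auto simp: norm_divide abs_of_pos\<close>)
  then show "?X \<in> closed_span \<mu> character {s. \<bar>s\<bar> \<ge> 1}"
    by (rule closed_span_if_reciprocal_not_integrable[OF inf])
  show "square_integrable \<mu> (\<lambda>u. l u * ?X u)"
  proof (rule square_integrable_bounded_spectral)
    fix u
    have "2 * cmod (l u) \<le> amp l u"
      using sum_squares_bound[of "cmod (l u)" 1] by (simp add: amp_def)
    then have "cmod (l u) \<le> amp l u" using norm_ge_zero[of "l u"] by linarith
    then show "cmod (l u * ?X u) \<le> 1" using a[of u] by (simp add: norm_mult norm_divide abs_of_pos)
  qed measurable
  show "(\<integral>u. amp l u * f u * (cmod (?X u - of_real (1 / amp l u)))\<^sup>2 \<partial>N) = 0" by simp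
qed

context
  assumes fin: "(\<integral>\<^sup>+u. 1 / ennreal (f u) \<partial>N) \<noteq> \<infinity>"
begin

lemma AE_f_pos: "AE u in N. 0 < f u"
proof -
  have "AE u in N. 1 / ennreal (f u) \<noteq> \<infinity>"
    by (rule nn_integral_noteq_infinite) (use fin in measurable)
  with AE_f_nonneg show ?thesis
    by eventually_elim (auto simp: less_le)
qed

lemma integrable_reciprocal: "integrable N (\<lambda>u. 1 / f u)"
proof (rule integrableI_nonneg)
  have "(\<integral>\<^sup>+u. ennreal (1 / f u) \<partial>N) = (\<integral>\<^sup>+u. 1 / ennreal (f u) \<partial>N)"
    by (rule nn_integral_cong_AE, use AE_f_pos in eventually_elim) (simp add: reciprocal_ennreal)
  then show "(\<integral>\<^sup>+u. ennreal (1 / f u) \<partial>N) < \<infinity>" using fin by (simp add: less_top)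
qed (use AE_f_nonneg in auto)

lemma integrable_bounded_by_integrable:
  fixes g :: "real \<Rightarrow> real"
  assumes "h \<in> borel_measurable N" "integrable N g" "AE u in N. \<bar>h u\<bar> \<le> g u"
  shows "integrable N h"
proof (rule Bochner_Integration.integrable_bound[OF assms(2,1)])
  show "AE u in N. norm (h u) \<le> norm (g u)" using assms(3) by eventually_elim simp
qed

lemma integrable_reciprocal_amp: "integrable N (\<lambda>u. 1 / (f u * amp l u))"
proof (rule integrable_bounded_by_integrable[OF _ integrable_reciprocal])
  show "AE u in N. \<bar>1 / (f u * amp l u)\<bar> \<le> 1 / f u"
    using AE_f_pos
  proof eventually_elim
    case (elim u)
    have "f u * 1 \<le> f u * amp l u" using elim amp_ge_1 by (intro mult_left_mono) auto
    then show ?case using elim amp_ge_1[of l u] by (simp add: abs_of_pos frac_le)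
  qed
qed measurable

lemma integrable_inverse_amp: "integrable N (\<lambda>u. 1 / amp l u)"
proof (rule integrable_bounded_by_integrable)
  interpret finite_measure N by (rule finite_measure_leb_circle)
  show "integrable N (\<lambda>_. 1 :: real)" by simp
  show "AE u in N. \<bar>1 / amp l u\<bar> \<le> 1"
  proof (intro AE_I2)
    show "\<bar>1 / amp l u\<bar> \<le> 1" for u using amp_ge_1[of l u] by simp
  qed
qed measurable

private abbreviation (input) P where "P \<equiv> inverse_amp_integral l"
private abbreviation (input) D where "D \<equiv> reciprocal_integral f l"

lemma D_pos: "D > 0"
proof -
  have pos: "AE u in N. 0 < 1 / (f u * amp l u)"
    using AE_f_pos by eventually_elim (use amp_ge_1 in \<open>auto intro!: mult_pos_pos intro: less_le_trans[OF zero_less_one]\<close>)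
  then have nn: "AE u in N. 0 \<le> 1 / (f u * amp l u)" by eventually_elim simp
  have "D \<noteq> 0"
  proof
    assume "D = 0"
    then have "AE u in N. 1 / (f u * amp l u) = 0"
      unfolding reciprocal_integral_def using integral_nonneg_eq_0_iff_AE[OF integrable_reciprocal_amp nn] by blast
    with pos have "AE u in N. False" by eventually_elim simp
    then have "emeasure N (space N) = 0" by (subst (asm) AE_iff_measurable[of "space N"]) (use sets.top[of N] in auto)
    then show False
      using measure_leb_circle by (simp add: measure_def space_restrict_space)
  qed
  then show ?thesis
    unfolding reciprocal_integral_def using integral_nonneg_AE[OF nn] by simp
qed

lemma D_eq: "enn2real (\<integral>\<^sup>+u. 1 / ennreal (f u * (1 + (cmod (l u))\<^sup>2)) \<partial>N) = D"
proof -
  have "(\<integral>\<^sup>+u. 1 / ennreal (f u * amp l u) \<partial>N) = (\<integral>\<^sup>+u. ennreal (1 / (f u * amp l u)) \<partial>N)"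
  proof (rule nn_integral_cong_AE, use AE_f_pos in eventually_elim)
    case (elim u)
    then have "0 < f u * amp l u" using amp_ge_1[of l u] by (intro mult_pos_pos) auto
    then show ?case by (rule reciprocal_ennreal)
  qed
  also have "\<dots> = ennreal D"
    unfolding reciprocal_integral_def
    by (rule nn_integral_eq_integral[OF integrable_reciprocal_amp], use AE_f_nonneg in eventually_elim)
       (use amp_ge_1 in \<open>auto intro!: divide_nonneg_nonneg mult_nonneg_nonneg intro: order_trans[OF zero_le_one]\<close>)
  finally show ?thesis using D_pos by (simp add: amp_def)
qed

lemma square_integrable_reciprocal: "square_integrable \<mu> (\<lambda>u. of_real (1 / f u))"
proof (subst square_integrable_spectral_iff)
  show "integrable N (\<lambda>u. f u * (cmod (complex_of_real (1 / f u)))\<^sup>2)"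
  proof (rule integrable_bounded_by_integrable[OF _ integrable_reciprocal])
    show "AE u in N. \<bar>f u * (cmod (complex_of_real (1 / f u)))\<^sup>2\<bar> \<le> 1 / f u"
      using AE_f_pos by eventually_elim (simp add: norm_divide power2_eq_square field_simps)
  qed measurable
qed measurable

text \<open>The reciprocal density represents integration with respect to Lebesgue measure; the observed
  characters have integral zero, so it is orthogonal to them.\<close>

lemma ip_reciprocal:
  assumes "square_integrable \<mu> X"
  shows "ip \<mu> X (\<lambda>u. of_real (1 / f u)) = (\<integral>u. X u \<partial>N)"
proof -
  have "AE u in N. of_real (f u) * complex_of_real (1 / f u) = 1"
    using AE_f_pos by eventually_elim (simp flip: of_real_mult)
  from ip_spectral_of_constant[OF assms square_integrable_reciprocal this] show ?thesis by simp
qed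

lemma integrable_if_square_integrable:
  assumes "square_integrable \<mu> X"
  shows "integrable N X"
proof -
  note [measurable] = assms[THEN square_integrable_measurable_spectral]
  have "integrable \<mu> (\<lambda>u. X u * cnj (of_real (1 / f u)))"
    by (rule integrable_mult_cnj[OF assms square_integrable_reciprocal])
  then have "integrable N (\<lambda>u. f u *\<^sub>R (X u * cnj (of_real (1 / f u))))"
    by (subst (asm) integrable_spectral) auto
  moreover have "AE u in N. f u *\<^sub>R (X u * cnj (of_real (1 / f u))) = X u"
    using AE_f_pos by eventually_elim (simp add: scaleR_conv_of_real)
  ultimately show ?thesis
    by (subst (asm) integrable_cong_AE) auto
qed

text \<open>The multiples of \<open>1 / f\<close> are the orthogonal complement of the observed characters.\<close>

lemma closed_span_iff_integral_zero:
  assumes X: "square_integrable \<mu> X"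
  shows "X \<in> closed_span \<mu> character {s. \<bar>s\<bar> \<ge> 1} \<longleftrightarrow> (\<integral>u. X u \<partial>N) = 0"
proof
  assume "X \<in> closed_span \<mu> character {s. \<bar>s\<bar> \<ge> 1}"
  then have "ip \<mu> X (\<lambda>u. of_real (1 / f u)) = 0"
  proof (rule ip_closed_span_eq_0[OF square_integrable_character square_integrable_reciprocal, rotated])
    fix s :: int assume "s \<in> {s. \<bar>s\<bar> \<ge> 1}"
    then have "ip \<mu> (character s) (\<lambda>u. of_real (1 / f u)) = 0"
      using integral_cis_leb_circle[of s] by (subst ip_reciprocal[OF square_integrable_character]) auto
    then show "ip \<mu> (\<lambda>u. of_real (1 / f u)) (character s) = 0"
      by (subst ip_cnj[symmetric]) simp
  qed
  then show "(\<integral>u. X u \<partial>N) = 0" using ip_reciprocal[OF X] by simp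
next
  assume zero: "(\<integral>u. X u \<partial>N) = 0"
  show "X \<in> closed_span \<mu> character {s. \<bar>s\<bar> \<ge> 1}"
  proof (rule closed_span_if_orthogonal[OF square_integrable_character X])
    fix r assume r: "square_integrable \<mu> r"
      and orth: "\<And>s. s \<in> {s. \<bar>s\<bar> \<ge> 1} \<Longrightarrow> ip \<mu> r (character s) = 0"
    obtain c where "AE u in N. of_real (f u) * r u = c"
      using orthogonal_to_nonzero_characters[OF r] orth by blast
    from ip_spectral_of_constant[OF X r this] show "ip \<mu> X r = 0" using zero by simp
  qed
qed

text \<open>Under the constraint that \<open>X\<close> has integral zero, the deviation from \<open>1 / amp l\<close> must integrate to \<open>- P\<close>;
  Cauchy-Schwarz with weight \<open>f * amp l\<close> then bounds its norm. The bound is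
  written as the square with the extremal deviation \<open>- (P / D) / (f * amp l)\<close> completed.\<close>

lemma deviation_lower_bound:
  assumes X: "X \<in> closed_span \<mu> character {s. \<bar>s\<bar> \<ge> 1}" and lX: "square_integrable \<mu> (\<lambda>u. l u * X u)"
  shows "P\<^sup>2 / D \<le> (\<integral>u. amp l u * f u * (cmod (X u - of_real (1 / amp l u)))\<^sup>2 \<partial>N)"
proof -
  have sX: "square_integrable \<mu> X" using X by (simp add: closed_span_iff)
  have intX: "integrable N X" by (rule integrable_if_square_integrable[OF sX])
  have zero: "(\<integral>u. X u \<partial>N) = 0" using X closed_span_iff_integral_zero[OF sX] by simp
  define c where "c = P / D"
  let ?h = "\<lambda>u. 2 * c * (1 / amp l u) - 2 * c * Re (X u) - c\<^sup>2 * (1 / (f u * amp l u))"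
  have "has_bochner_integral N (\<lambda>u. Re (X u)) 0"
    using has_bochner_integral_integrable[OF integrable_Re[OF intX]] integral_Re[OF intX] zero by simp
  then have h: "has_bochner_integral N ?h (2 * c * P - 2 * c * 0 - c\<^sup>2 * D)"
    unfolding inverse_amp_integral_def reciprocal_integral_def
    by (intro has_bochner_integral_diff has_bochner_integral_mult_right has_bochner_integral_integrable
          integrable_inverse_amp integrable_reciprocal_amp)
  then have "(\<integral>u. ?h u \<partial>N) = P\<^sup>2 / D"
    using D_pos by (subst has_bochner_integral_integral_eq[OF h]) (simp add: c_def power2_eq_square field_simps)
  moreover have "(\<integral>u. ?h u \<partial>N) \<le> (\<integral>u. amp l u * f u * (cmod (X u - of_real (1 / amp l u)))\<^sup>2 \<partial>N)"
  proof (rule integral_mono_AE)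
    show "integrable N ?h"
      using h by (rule integrable.intros)
    show "integrable N (\<lambda>u. amp l u * f u * (cmod (X u - of_real (1 / amp l u)))\<^sup>2)"
      by (rule amp_identity(1)[OF sX lX])
    show "AE u in N. ?h u \<le> amp l u * f u * (cmod (X u - of_real (1 / amp l u)))\<^sup>2"
      using AE_f_pos
    proof eventually_elim
      case (elim u)
      let ?b = "f u * amp l u" and ?x = "X u - of_real (1 / amp l u)"
      have square: "(b * x + c)\<^sup>2 / b = b * x\<^sup>2 + 2 * c * x + c\<^sup>2 * (1 / b)" if "b > 0" for b x :: real
        using that by (simp add: field_simps power2_eq_square)
      have b: "?b > 0" using elim amp_ge_1[of l u] by (intro mult_pos_pos) auto
      have "0 \<le> (?b * Re ?x + c)\<^sup>2 / ?b" using b by simp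
      also have "\<dots> = ?b * (Re ?x)\<^sup>2 + 2 * c * Re ?x + c\<^sup>2 * (1 / ?b)"
        by (rule square[OF b])
      also have "\<dots> = ?b * (Re ?x)\<^sup>2 - ?h u" by (simp add: right_diff_distrib)
      also have "\<dots> \<le> ?b * (cmod ?x)\<^sup>2 - ?h u"
        using b by (intro diff_right_mono mult_left_mono) (auto simp: cmod_power2)
      finally show ?case by (simp add: mult.commute)
    qed
  qed
  ultimately show ?thesis by simp
qed

text \<open>Equality in the lower bound forces the deviation to be proportional to \<open>1 / (f * amp l)\<close>; the factor
  \<open>P / D\<close> is the one that makes the integral of the predictor vanish. The filtered predictor has finite
  norm because \<open>amp l\<close> dominates \<open>\<bar>l\<bar>\<^sup>2\<close>.\<close>

lemma optimal_of_reciprocal_integrable: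
  obtains X where "X \<in> closed_span \<mu> character {s. \<bar>s\<bar> \<ge> 1}" "square_integrable \<mu> (\<lambda>u. l u * X u)"
    "(\<integral>u. amp l u * f u * (cmod (X u - of_real (1 / amp l u)))\<^sup>2 \<partial>N) = P\<^sup>2 / D"
proof
  define c where "c = P / D"
  define x where "x u = 1 / amp l u - c * (1 / (f u * amp l u))" for u
  let ?X = "\<lambda>u. complex_of_real (x u)"
  have [measurable]: "x \<in> borel_measurable N" unfolding x_def by measurable
  have a: "amp l u > 0" for u using amp_ge_1[of l u] by linarith
  have bound: "AE u in N. f u * (amp l u * (x u)\<^sup>2) \<le> 2 * f u + 2 * c\<^sup>2 * (1 / (f u * amp l u))"
    using AE_f_pos
  proof eventually_elim
    case (elim u)
    have "(x u)\<^sup>2 \<le> 2 * (1 / amp l u)\<^sup>2 + 2 * (c * (1 / (f u * amp l u)))\<^sup>2"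
      using norm_add_sq_le[of "of_real (1 / amp l u)" "of_real (- (c * (1 / (f u * amp l u))))"]
      unfolding of_real_add[symmetric] norm_of_real by (simp add: x_def power_divide)
    then have "f u * amp l u * (x u)\<^sup>2 \<le> f u * amp l u * (2 * (1 / amp l u)\<^sup>2 + 2 * (c * (1 / (f u * amp l u)))\<^sup>2)"
      using elim a[of u] by (intro mult_left_mono) auto
    also have "\<dots> = 2 * f u * (1 / amp l u) + 2 * c\<^sup>2 * (1 / (f u * amp l u))"
      using elim a[of u] by (simp add: field_simps power2_eq_square)
    also have "2 * f u * (1 / amp l u) \<le> 2 * f u * 1"
      using elim amp_ge_1[of l u] by (intro mult_left_mono) auto
    finally show ?case by (simp add: mult.assoc)
  qed
  have int_bound: "integrable N (\<lambda>u. 2 * f u + 2 * c\<^sup>2 * (1 / (f u * amp l u)))"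
    by (intro Bochner_Integration.integrable_add integrable_mult_right f_integrable integrable_reciprocal_amp)
  have sq: "square_integrable \<mu> Y"
    if [measurable]: "Y \<in> borel_measurable N" and Y: "\<And>u. (cmod (Y u))\<^sup>2 \<le> amp l u * (x u)\<^sup>2" for Y
  proof (subst square_integrable_spectral_iff)
    show "integrable N (\<lambda>u. f u * (cmod (Y u))\<^sup>2)"
    proof (rule integrable_bounded_by_integrable[OF _ int_bound])
      show "AE u in N. \<bar>f u * (cmod (Y u))\<^sup>2\<bar> \<le> 2 * f u + 2 * c\<^sup>2 * (1 / (f u * amp l u))"
        using bound AE_f_nonneg
      proof eventually_elim
        case (elim u)
        have "f u * (cmod (Y u))\<^sup>2 \<le> f u * (amp l u * (x u)\<^sup>2)"
          using elim(2) Y by (intro mult_left_mono)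
        with elim show ?case by simp
      qed
    qed measurable
  qed measurable
  have sX: "square_integrable \<mu> ?X"
  proof (rule sq)
    show "(cmod (?X u))\<^sup>2 \<le> amp l u * (x u)\<^sup>2" for u
      using mult_right_mono[OF amp_ge_1[of l u], of "(x u)\<^sup>2"] by simp
  qed measurable
  show "square_integrable \<mu> (\<lambda>u. l u * ?X u)"
    by (rule sq) (auto simp: norm_mult power_mult_distrib amp_def intro: mult_right_mono)
  have "has_bochner_integral N x (P - c * D)"
    unfolding x_def[abs_def] inverse_amp_integral_def reciprocal_integral_def
    by (intro has_bochner_integral_diff has_bochner_integral_mult_right has_bochner_integral_integrable
          integrable_inverse_amp integrable_reciprocal_amp)
  then have "(\<integral>u. x u \<partial>N) = P - c * D" by (rule has_bochner_integral_integral_eq)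
  also have "\<dots> = 0" using D_pos by (simp add: c_def)
  finally have "(\<integral>u. ?X u \<partial>N) = 0" by (simp only: integral_complex_of_real) simp
  then show "?X \<in> closed_span \<mu> character {s. \<bar>s\<bar> \<ge> 1}"
    using closed_span_iff_integral_zero[OF sX] by simp
  have "(\<integral>u. amp l u * f u * (cmod (?X u - of_real (1 / amp l u)))\<^sup>2 \<partial>N) = (\<integral>u. c\<^sup>2 * (1 / (f u * amp l u)) \<partial>N)"
  proof (rule integral_cong_AE)
    show "AE u in N. amp l u * f u * (cmod (?X u - of_real (1 / amp l u)))\<^sup>2 = c\<^sup>2 * (1 / (f u * amp l u))"
      using AE_f_pos
    proof eventually_elim
      case (elim u)
      have "(cmod (?X u - of_real (1 / amp l u)))\<^sup>2 = (c * (1 / (f u * amp l u)))\<^sup>2"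
        unfolding of_real_diff[symmetric] norm_of_real by (simp add: x_def power_divide)
      then show ?case using elim a[of u] by (simp add: field_simps power2_eq_square)
    qed
  qed measurable
  also have "\<dots> = c\<^sup>2 * D"
    by (simp only: Bochner_Integration.integral_mult_right_zero reciprocal_integral_def)
  also have "\<dots> = P\<^sup>2 / D"
    using D_pos by (simp add: c_def power2_eq_square)
  finally show "(\<integral>u. amp l u * f u * (cmod (?X u - of_real (1 / amp l u)))\<^sup>2 \<partial>N) = P\<^sup>2 / D" .
qed

end

end

section \<open>The interpolation error\<close>

theorem theorem6p1:
  fixes M :: "'a measure"
    and B :: "int \<Rightarrow> 'a \<Rightarrow> complex"
    and W :: "real set \<Rightarrow> 'a \<Rightarrow> complex"
    and f :: "real \<Rightarrow> real"
    and l :: "real \<Rightarrow> complex"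
  assumes "prob_space M"
    and "wide_sense_stationary M B"
    and "has_spectral_density M B f"
    and "spectral_representation M B (density_measure f) W"
    and "l \<in> borel_measurable leb_circle"
  shows "((\<integral>\<^sup>+u. 1 / ennreal (f u) \<partial>leb_circle) = \<infinity> \<longrightarrow>
           sigma_int_sq M B (density_measure f) W l
             = (\<integral>u. (cmod (l u))\<^sup>2 / (1 + (cmod (l u))\<^sup>2) * f u \<partial>leb_circle)) \<and>
         ((\<integral>\<^sup>+u. 1 / ennreal (f u) \<partial>leb_circle) \<noteq> \<infinity> \<longrightarrow>
           sigma_int_sq M B (density_measure f) W l
             = (\<integral>u. (cmod (l u))\<^sup>2 * f u / (1 + (cmod (l u))\<^sup>2) \<partial>leb_circle)
               + (\<integral>u. 1 / (1 + (cmod (l u))\<^sup>2) \<partial>leb_circle)\<^sup>2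
                 * inverse (enn2real (\<integral>\<^sup>+u. 1 / ennreal (f u * (1 + (cmod (l u))\<^sup>2)) \<partial>leb_circle)))"
proof -
  let ?N = leb_circle and ?\<mu> = "density_measure f" and ?T = "{s::int. \<bar>s\<bar> \<ge> 1}"
  let ?V = "\<integral>u. (cmod (l u))\<^sup>2 / (1 + (cmod (l u))\<^sup>2) * f u \<partial>?N"
  let ?R = "\<lambda>X. \<integral>u. amp l u * f u * (cmod (X u - of_real (1 / amp l u)))\<^sup>2 \<partial>?N"
  have W: "orthogonal_random_measure M ?\<mu> W"
    and B: "\<And>s. has_stoch_integral M ?\<mu> W (character s) (B s)"
    using assms(4) by (auto simp: spectral_representation_def)
  have fm: "f \<in> borel_measurable ?N" and f0: "\<And>u. u \<in> {-pi..<pi} \<Longrightarrow> 0 \<le> f u"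
    and fin: "finite_measure ?\<mu>"
    using assms(3) by (auto simp: has_spectral_density_def is_spectral_measure_def)
  have AE0: "AE u in ?N. 0 \<le> f u" using f0 by (intro AE_I2) (simp add: space_restrict_space)
  have f: "integrable ?N f"
  proof -
    interpret finite_measure ?\<mu> by (rule fin)
    have "integrable ?\<mu> (\<lambda>_. 1 :: real)" by simp
    then show ?thesis using fm AE0 by (subst (asm) integrable_density) auto
  qed
  note l = assms(5)
  have sigma: "sigma_int_sq M B ?\<mu> W l = v + ?V"
    if X: "X \<in> closed_span ?\<mu> character ?T" "square_integrable ?\<mu> (\<lambda>u. l u * X u)" "?R X = v"
      and le: "\<And>Y. Y \<in> closed_span ?\<mu> character ?T \<Longrightarrow> square_integrable ?\<mu> (\<lambda>u. l u * Y u) \<Longrightarrow> v \<le> ?R Y"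
    for X v
  proof (rule sigma_int_sq_eqI[OF W fin B _ X(1,2)])
    have sq: "square_integrable ?\<mu> Y" if "Y \<in> closed_span ?\<mu> character ?T" for Y
      using that by (simp add: closed_span_iff)
    show "l \<in> borel_measurable ?\<mu>" using l by simp
    show "L2_dist_sq ?\<mu> X (character 0) + (\<integral>u. (cmod (l u * X u))\<^sup>2 \<partial>?\<mu>) = v + ?V"
      using amp_identity(2)[OF f f0 l sq[OF X(1)] X(2)] X(3) by simp
    fix Y assume Y: "Y \<in> closed_span ?\<mu> character ?T" "square_integrable ?\<mu> (\<lambda>u. l u * Y u)"
    show "v + ?V \<le> L2_dist_sq ?\<mu> Y (character 0) + (\<integral>u. (cmod (l u * Y u))\<^sup>2 \<partial>?\<mu>)"
      using amp_identity(2)[OF f f0 l sq[OF Y(1)] Y(2)] le[OF Y] by simp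
  qed
  show ?thesis
  proof (intro conjI impI)
    assume inf: "(\<integral>\<^sup>+u. 1 / ennreal (f u) \<partial>?N) = \<infinity>"
    obtain X where X: "X \<in> closed_span ?\<mu> character ?T" "square_integrable ?\<mu> (\<lambda>u. l u * X u)" "?R X = 0"
      using optimal_of_reciprocal_not_integrable[OF f f0 l inf] by blast
    have "0 \<le> ?R Y" for Y
    proof (rule integral_nonneg_AE)
      show "AE u in ?N. 0 \<le> amp l u * f u * (cmod (Y u - of_real (1 / amp l u)))\<^sup>2"
        using AE0
      proof eventually_elim
        case (elim u)
        then show ?case using amp_ge_1[of l u] by (intro mult_nonneg_nonneg) auto
      qed
    qed
    with sigma[OF X] show "sigma_int_sq M B ?\<mu> W l = ?V" by simp
  next
    assume fin': "(\<integral>\<^sup>+u. 1 / ennreal (f u) \<partial>?N) \<noteq> \<infinity>"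
    obtain X where X: "X \<in> closed_span ?\<mu> character ?T" "square_integrable ?\<mu> (\<lambda>u. l u * X u)"
        "?R X = (inverse_amp_integral l)\<^sup>2 / reciprocal_integral f l"
      using optimal_of_reciprocal_integrable[OF f f0 l fin'] by blast
    from sigma[OF X deviation_lower_bound[OF f f0 l fin']]
    have "sigma_int_sq M B ?\<mu> W l = (inverse_amp_integral l)\<^sup>2 / reciprocal_integral f l + ?V" by simp
    moreover have "inverse_amp_integral l = (\<integral>u. 1 / (1 + (cmod (l u))\<^sup>2) \<partial>?N)"
      unfolding inverse_amp_integral_def by (simp add: amp_def)
    moreover note D_eq[OF f f0 l fin', symmetric]
    ultimately show "sigma_int_sq M B ?\<mu> W l
        = (\<integral>u. (cmod (l u))\<^sup>2 * f u / (1 + (cmod (l u))\<^sup>2) \<partial>?N)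
          + (\<integral>u. 1 / (1 + (cmod (l u))\<^sup>2) \<partial>?N)\<^sup>2
            * inverse (enn2real (\<integral>\<^sup>+u. 1 / ennreal (f u * (1 + (cmod (l u))\<^sup>2)) \<partial>?N))"
      by (simp only: divide_inverse times_divide_eq_left) (simp add: mult_ac)
  qed
qed

end
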